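(* Let $\tau\in\mathbf C$, $\tau\neq2$. Suppose that $\rho\in\mathcal X_\tau$ does not satisfy the extended BQ-conditions, that is, either $\mathrm{tr}\,\rho(g)\in(-2,2)$ for some $[g]\in\hat\Omega$ or $|\mathrm{tr}\,\rho(g)|\le 2$ for infinitely many $[g]\in\hat\Omega$. Then there exist a sequence of distinct elements $H_i\in\mathcal{MCG}$ and $\rho_0\in\mathcal X_\tau$ such that $H_i(\rho)$ converges to $\rho_0$ in $\mathcal X_\tau$.
   Context: $\Gamma=\langle a,b\rangle$ is the free group of rank two, the fundamental group of a once-punctured torus $\mathbb T$. On $\Gamma$ let $g\sim h$ iff $g$ is conjugate to $h$ or $h^{-1}$; $\hat\Omega\subset\Gamma/\!\sim$ is the set of classes corresponding to non-trivial, non-peripheral simple closed curves on $\mathbb T$ (equivalently, classes of elements belonging to a free basis). A $\tau$-representation is a homomorphism $\rho:\Gamma\to\mathrm{SL}(2,\mathbf C)$ with $\mathrm{tr}\,\rho(aba^{-1}b^{-1})=\tau$. $\mathcal X_\tau$ is the set of $\tau$-representations modulo conjugation in $\mathrm{SL}(2,\mathbf C)$. For $\tau\neq2$, $[\rho]\mapsto(\mathrm{tr}\,\rho(a),\mathrm{tr}\,\rho(b),\mathrm{tr}\,\rho(ab))$ identifies $\mathcal X_\tau$ with $\{(x,y,z)\in\mathbf C^3: x^2+y^2+z^2-xyz=\tau+2\}$, from which $\mathcal X_\tau$ gets its topology. $\mathcal{MCG}\cong\mathrm{SL}(2,\mathbf Z)$ is the mapping class group of $\mathbb T$; it acts on $\mathcal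 X_\tau$ by $H(\rho)(g)=\rho(H_*(g))$, where $H_*$ is the automorphism of $\Gamma$ (well defined up to inner automorphisms) induced by $H$. *)

theory Defs
  imports "HOL-Analysis.Analysis" "HOL-Algebra.Coset" "HOL-Algebra.Bij"
begin

section \<open>The free group of rank two\<close>

text \<open>
  A letter \<open>(s, True)\<close> stands for the generator \<open>s\<close>, and \<open>(s, False)\<close> for its inverse.  Elements of
  the free group are freely reduced words, and \<open>push l w\<close> is the free reduction of \<open>l # w\<close>.
\<close>

datatype gen = gen_a | gen_b

type_synonym letter = "gen \<times> bool"

definition flip_letter :: "letter \<Rightarrow> letter" where
  "flip_letter l = (fst l, \<not> snd l)"

fun reduced :: "letter list \<Rightarrow> bool" where
  "reduced [] \<longleftrightarrow> True"
| "reduced [l] \<longleftrightarrow> True"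
| "reduced (k # l # w) \<longleftrightarrow> l \<noteq> flip_letter k \<and> reduced (l # w)"

fun push :: "letter \<Rightarrow> letter list \<Rightarrow> letter list" where
  "push l [] = [l]"
| "push l (k # w) = (if k = flip_letter l then w else l # k # w)"

definition \<Gamma> :: "letter list monoid" where
  "\<Gamma> = \<lparr>carrier = {w. reduced w}, mult = foldr push, one = []\<rparr>"

definition elt_a :: "letter list" where "elt_a = [(gen_a, True)]"
definition elt_b :: "letter list" where "elt_b = [(gen_b, True)]"

fun letter_eval :: "('g, 'm) monoid_scheme \<Rightarrow> 'g \<Rightarrow> 'g \<Rightarrow> letter \<Rightarrow> 'g" where
  "letter_eval G u v (s, e) =
     (let x = (case s of gen_a \<Rightarrow> u | gen_b \<Rightarrow> v) in if e then x else inv\<^bsub>G\<^esub> x)"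

definition word_eval :: "('g, 'm) monoid_scheme \<Rightarrow> 'g \<Rightarrow> 'g \<Rightarrow> letter list \<Rightarrow> 'g" where
  "word_eval G u v w = foldr (\<lambda>l. mult G (letter_eval G u v l)) w \<one>\<^bsub>G\<^esub>"

text \<open>
  \<open>u, v\<close> form a free basis if every element of the free group is the value of exactly one
  reduced word in \<open>u, v\<close>.
\<close>

definition free_basis :: "letter list \<Rightarrow> letter list \<Rightarrow> bool" where
  "free_basis u v \<longleftrightarrow> u \<in> carrier \<Gamma> \<and> v \<in> carrier \<Gamma> \<and>
     bij_betw (word_eval \<Gamma> u v) {w. reduced w} (carrier \<Gamma>)"

definition conjugate :: "letter list \<Rightarrow> letter list \<Rightarrow> letter list" where
  "conjugate k g = k \<otimes>\<^bsub>\<Gamma>\<^esub> g \<otimes>\<^bsub>\<Gamma>\<^esub> inv\<^bsub>\<Gamma>\<^esub> k"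

definition comm_ab :: "letter list" where
  "comm_ab = elt_a \<otimes>\<^bsub>\<Gamma>\<^esub> elt_b \<otimes>\<^bsub>\<Gamma>\<^esub> inv\<^bsub>\<Gamma>\<^esub> elt_a \<otimes>\<^bsub>\<Gamma>\<^esub> inv\<^bsub>\<Gamma>\<^esub> elt_b"


section \<open>Simple closed curves\<close>

definition curve_rel :: "(letter list \<times> letter list) set" where
  "curve_rel = {(g, h). g \<in> carrier \<Gamma> \<and> h \<in> carrier \<Gamma> \<and>
     (\<exists>k\<in>carrier \<Gamma>. h = conjugate k g \<or> h = conjugate k (inv\<^bsub>\<Gamma>\<^esub> g))}"

abbreviation curve_class :: "letter list \<Rightarrow> letter list set" where
  "curve_class g \<equiv> curve_rel `` {g}"

text \<open>
  The classes, in the quotient of the free group by \<open>curve_rel\<close>, of the non-trivial, non-peripheral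
  simple closed curves on the once-punctured torus are those of the elements of free bases.
\<close>

definition \<Omega> :: "letter list set set" where
  "\<Omega> = {curve_class g | g. \<exists>u v. free_basis u v \<and> g \<in> {u, v}}"


section \<open>The mapping class group of the once-punctured torus\<close>

text \<open>
  By the Dehn--Nielsen--Baer theorem, the mapping class group (of orientation-preserving classes) of
  the once-punctured torus is the group of outer automorphisms of its fundamental group that preserve
  the conjugacy class of the oriented peripheral element \<open>aba\<inverse>b\<inverse>\<close>.  Every automorphism of the free group
  maps \<open>aba\<inverse>b\<inverse>\<close> to a conjugate of itself or of its inverse, according to whether it acts on the
  abelianization with determinant \<open>1\<close> or \<open>-1\<close>; so the group below is isomorphic to \<open>SL(2,Z)\<close>.
  A mapping class \<open>H\<close> is thus the coset of all automorphisms that it induces.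
\<close>

definition Aut_plus :: "(letter list \<Rightarrow> letter list) set" where
  "Aut_plus = {\<phi> \<in> auto \<Gamma>. \<exists>k\<in>carrier \<Gamma>. \<phi> comm_ab = conjugate k comm_ab}"

definition inner :: "letter list \<Rightarrow> letter list \<Rightarrow> letter list" where
  "inner k = (\<lambda>g\<in>carrier \<Gamma>. conjugate k g)"

definition Inner :: "(letter list \<Rightarrow> letter list) set" where
  "Inner = inner ` carrier \<Gamma>"

definition MCG :: "(letter list \<Rightarrow> letter list) set monoid" where
  "MCG = (AutoGroup \<Gamma>)\<lparr>carrier := Aut_plus\<rparr> Mod Inner"


section \<open>Representations\<close>

definition SL2C :: "(complex^2^2) monoid" where
  "SL2C = \<lparr>carrier = {A. det A = 1}, mult = (**), one = mat 1\<rparr>"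

text \<open>
  Representations are extensional functions, so that two of them are equal as soon as they agree on
  reduced words.
\<close>

definition tau_reps :: "complex \<Rightarrow> (letter list \<Rightarrow> complex^2^2) set" where
  "tau_reps \<tau> = {\<rho> \<in> hom \<Gamma> SL2C \<inter> extensional (carrier \<Gamma>). trace (\<rho> comm_ab) = \<tau>}"

definition conj_rel ::
    "complex \<Rightarrow> ((letter list \<Rightarrow> complex^2^2) \<times> (letter list \<Rightarrow> complex^2^2)) set" where
  "conj_rel \<tau> = {(\<rho>, \<sigma>). \<rho> \<in> tau_reps \<tau> \<and> \<sigma> \<in> tau_reps \<tau> \<and>
     (\<exists>P\<in>carrier SL2C. \<forall>g\<in>carrier \<Gamma>. \<sigma> g = P \<otimes>\<^bsub>SL2C\<^esub> \<rho> g \<otimes>\<^bsub>SL2C\<^esub> inv\<^bsub>SL2C\<^esub> P)}"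

definition \<X> :: "complex \<Rightarrow> (letter list \<Rightarrow> complex^2^2) set set" where
  "\<X> \<tau> = tau_reps \<tau> // conj_rel \<tau>"

text \<open>The common value of the trace of \<open>\<rho> g\<close> over all \<open>\<rho>\<close> in a conjugacy class \<open>c\<close>.\<close>

definition tr :: "(letter list \<Rightarrow> complex^2^2) set \<Rightarrow> letter list \<Rightarrow> complex" where
  "tr c g = the_elem ((\<lambda>\<rho>. trace (\<rho> g)) ` c)"

definition cubic_surface :: "complex \<Rightarrow> (complex \<times> complex \<times> complex) set" where
  "cubic_surface \<tau> = {(x, y, z). x\<^sup>2 + y\<^sup>2 + z\<^sup>2 - x * y * z = \<tau> + 2}"

definition trace_coords :: "(letter list \<Rightarrow> complex^2^2) set \<Rightarrow> complex \<times> complex \<times> complex" where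
  "trace_coords c = (tr c elt_a, tr c elt_b, tr c (elt_a \<otimes>\<^bsub>\<Gamma>\<^esub> elt_b))"

definition X_topology :: "complex \<Rightarrow> (letter list \<Rightarrow> complex^2^2) set topology" where
  "X_topology \<tau> = pullback_topology (\<X> \<tau>) trace_coords (top_of_set (cubic_surface \<tau>))"

text \<open>
  The class of \<open>\<rho> \<circ> H\<^sub>*\<close>.  Letting \<open>\<rho>\<close> range over the whole class \<open>c\<close>, and \<open>H\<^sub>*\<close> over all automorphisms
  in \<open>H\<close>, gives exactly one conjugacy class (\<open>mcg_act_class\<close> below).
\<close>

definition mcg_act :: "(letter list \<Rightarrow> letter list) set \<Rightarrow> (letter list \<Rightarrow> complex^2^2) set
    \<Rightarrow> (letter list \<Rightarrow> complex^2^2) set" where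
  "mcg_act H c = {compose (carrier \<Gamma>) \<rho> \<phi> | \<rho> \<phi>. \<rho> \<in> c \<and> \<phi> \<in> H}"

text \<open>The interval \<open>(-2,2)\<close> is the real one.\<close>

definition extended_BQ :: "(letter list \<Rightarrow> complex^2^2) set \<Rightarrow> bool" where
  "extended_BQ c \<longleftrightarrow>
     (\<forall>g\<in>carrier \<Gamma>. curve_class g \<in> \<Omega> \<longrightarrow> tr c g \<notin> complex_of_real ` {-2<..<2}) \<and>
     finite {curve_class g | g. g \<in> carrier \<Gamma> \<and> curve_class g \<in> \<Omega> \<and> cmod (tr c g) \<le> 2}"

section \<open>Well-definedness\<close>

lemma flip_flip [simp]: "flip_letter (flip_letter l) = l"
  by (simp add: flip_letter_def)

lemma reduced_tl: "reduced (l # w) \<Longrightarrow> reduced w"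
  by (cases w) auto

lemma reduced_push: "reduced w \<Longrightarrow> reduced (push l w)"
  by (cases w) (auto dest: reduced_tl)

lemma reduced_foldr_push: "reduced v \<Longrightarrow> reduced (foldr push u v)"
  by (induction u) (auto intro: reduced_push)

lemma push_flip:
  assumes "reduced w"
  shows "push (flip_letter l) (push l w) = w" "push l (push (flip_letter l) w) = w"
  using assms by (cases w rule: reduced.cases; auto)+

lemma foldr_push_push:
  assumes "reduced w"
  shows "foldr push (push l u) w = push l (foldr push u w)"
  using assms by (cases u) (auto simp: push_flip reduced_foldr_push)

lemma foldr_push_foldr_push:
  "reduced w \<Longrightarrow> foldr push (foldr push u v) w = foldr push u (foldr push v w)"
  by (induction u) (simp_all add: foldr_push_push)

lemma foldr_push_Nil: "reduced u \<Longrightarrow> foldr push u [] = u"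
proof (induction u)
  case (Cons l u)
  then show ?case by (cases u) (auto dest: reduced_tl)
qed simp

lemma foldr_push_inverse:
  "reduced w \<Longrightarrow> foldr push (rev (map flip_letter u)) (foldr push u w) = w"
  by (induction u arbitrary: w) (simp_all add: push_flip reduced_foldr_push)

lemma carrier_Gamma [simp]: "carrier \<Gamma> = {w. reduced w}"
  and mult_Gamma: "u \<otimes>\<^bsub>\<Gamma>\<^esub> v = foldr push u v"
  and one_Gamma: "\<one>\<^bsub>\<Gamma>\<^esub> = []"
  by (simp_all add: \<Gamma>_def)

lemma group_Gamma: "group \<Gamma>"
proof (rule groupI)
  fix u assume u: "u \<in> carrier \<Gamma>"
  let ?v = "foldr push (rev (map flip_letter u)) []"
  have "?v \<otimes>\<^bsub>\<Gamma>\<^esub> u = \<one>\<^bsub>\<Gamma>\<^esub>"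
    using u foldr_push_inverse[of "[]" u]
    by (simp add: mult_Gamma one_Gamma foldr_push_foldr_push foldr_push_Nil)
  moreover have "?v \<in> carrier \<Gamma>"
    by (simp add: reduced_foldr_push)
  ultimately show "\<exists>v\<in>carrier \<Gamma>. v \<otimes>\<^bsub>\<Gamma>\<^esub> u = \<one>\<^bsub>\<Gamma>\<^esub>" by blast
qed (auto simp: mult_Gamma one_Gamma reduced_foldr_push foldr_push_foldr_push)

lemma elt_closed [simp]: "reduced elt_a" "reduced elt_b"
  by (simp_all add: elt_a_def elt_b_def)

text \<open>The universal property of the free group on \<open>a, b\<close>.\<close>

lemma letter_eval_closed:
  assumes "group G" "u \<in> carrier G" "v \<in> carrier G"
  shows "letter_eval G u v l \<in> carrier G"
  using assms by (cases l) (auto simp: Let_def split: gen.split)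

lemma word_eval_closed:
  assumes "group G" "u \<in> carrier G" "v \<in> carrier G"
  shows "word_eval G u v w \<in> carrier G"
proof -
  interpret group G by fact
  show ?thesis
    unfolding word_eval_def by (induction w) (use assms in \<open>auto intro: letter_eval_closed\<close>)
qed

lemma letter_eval_flip:
  assumes "group G" "u \<in> carrier G" "v \<in> carrier G"
  shows "letter_eval G u v (flip_letter l) = inv\<^bsub>G\<^esub> letter_eval G u v l"
proof -
  interpret group G by fact
  show ?thesis
    using assms by (cases l) (auto simp: flip_letter_def Let_def split: gen.split)
qed

lemma word_eval_push:
  assumes "group G" "u \<in> carrier G" "v \<in> carrier G"
  shows "word_eval G u v (push l w) = letter_eval G u v l \<otimes>\<^bsub>G\<^esub> word_eval G u v w"
proof -
  interpret group G by fact
  show ?thesis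
  proof (cases w)
    case (Cons k x)
    have "word_eval G u v x \<in> carrier G" "letter_eval G u v l \<in> carrier G"
      using assms by (auto intro: word_eval_closed letter_eval_closed)
    then show ?thesis
      using Cons letter_eval_flip[OF assms, of l]
      by (auto simp: word_eval_def simp flip: m_assoc)
  qed (simp add: word_eval_def)
qed

lemma word_eval_hom:
  assumes "group G" "u \<in> carrier G" "v \<in> carrier G"
  shows "word_eval G u v \<in> hom \<Gamma> G"
proof -
  interpret group G by fact
  have "word_eval G u v (foldr push x y) = word_eval G u v x \<otimes>\<^bsub>G\<^esub> word_eval G u v y" for x y
  proof (induction x)
    case Nil
    then show ?case using assms word_eval_closed[OF assms] by (simp add: word_eval_def)
  next
    case (Cons l x)
    have "word_eval G u v (l # x) = letter_eval G u v l \<otimes>\<^bsub>G\<^esub> word_eval G u v x"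
      by (simp add: word_eval_def)
    then show ?case
      using Cons letter_eval_closed[OF assms] word_eval_closed[OF assms]
      by (simp add: word_eval_push[OF assms] m_assoc)
  qed
  then show ?thesis
    by (auto simp: hom_def mult_Gamma word_eval_closed[OF assms])
qed

lemma word_eval_elt:
  assumes "group G" "u \<in> carrier G" "v \<in> carrier G"
  shows "word_eval G u v elt_a = u" "word_eval G u v elt_b = v"
  using assms by (simp_all add: word_eval_def elt_a_def elt_b_def group.is_monoid monoid.r_one)

lemma inv_letter_Gamma: "inv\<^bsub>\<Gamma>\<^esub> [l] = [flip_letter l]"
  by (rule group.inv_equality[OF group_Gamma]) (simp_all add: mult_Gamma one_Gamma)

lemma hom_eq_word_eval:
  assumes "group G" "f \<in> hom \<Gamma> G" "w \<in> carrier \<Gamma>"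
  shows "f w = word_eval G (f elt_a) (f elt_b) w"
proof -
  interpret group_hom \<Gamma> G f
    using assms group_Gamma by (simp add: group_hom_def group_hom_axioms_def)
  have letter: "f [l] = letter_eval G (f elt_a) (f elt_b) l" for l
  proof -
    obtain s e where l: "l = (s, e)" by (cases l)
    have "f [(s, False)] = inv\<^bsub>G\<^esub> f [(s, True)]"
      using hom_inv[of "[(s, True)]"] by (simp add: inv_letter_Gamma flip_letter_def)
    then show ?thesis
      using l by (cases s; cases e) (simp_all add: elt_a_def elt_b_def)
  qed
  show ?thesis
    using assms(3)
  proof (induction w)
    case Nil
    then show ?case using hom_one by (simp add: one_Gamma word_eval_def)
  next
    case (Cons l w)
    then have "reduced w" "l # w = [l] \<otimes>\<^bsub>\<Gamma>\<^esub> w"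
      using foldr_push_Nil[of "l # w"] foldr_push_Nil[of w]
      by (auto simp: mult_Gamma dest: reduced_tl)
    then have "f (l # w) = f [l] \<otimes>\<^bsub>G\<^esub> f w"
      by (metis carrier_Gamma hom_mult mem_Collect_eq reduced.simps(2))
    then show ?case
      using Cons \<open>reduced w\<close> by (simp add: letter word_eval_def)
  qed
qed

lemma SL2C_simps [simp]:
  "carrier SL2C = {A. det A = 1}" "A \<otimes>\<^bsub>SL2C\<^esub> B = A ** B" "\<one>\<^bsub>SL2C\<^esub> = mat 1"
  by (simp_all add: SL2C_def)

lemma group_SL2C: "group SL2C"
proof (rule groupI)
  fix A :: "complex^2^2" assume "A \<in> carrier SL2C"
  then have A: "det A = 1" by simp
  then have "invertible A" by (simp add: invertible_det_nz)
  then obtain B where B: "B ** A = mat 1" by (auto simp: invertible_def)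
  then have "det B * det A = 1" by (metis det_I det_mul)
  then show "\<exists>B\<in>carrier SL2C. B \<otimes>\<^bsub>SL2C\<^esub> A = \<one>\<^bsub>SL2C\<^esub>"
    using A B by (auto simp del: carrier_Gamma)
qed (auto simp: det_mul matrix_mul_assoc)

lemma trace_mult_commute: "trace (A ** B) = trace (B ** (A :: complex^2^2))"
  by (simp add: trace_def matrix_matrix_mult_def sum_2 algebra_simps)

lemma trace_conj:
  assumes "P \<in> carrier SL2C"
  shows "trace (P \<otimes>\<^bsub>SL2C\<^esub> A \<otimes>\<^bsub>SL2C\<^esub> inv\<^bsub>SL2C\<^esub> P) = trace A"
proof -
  have "inv\<^bsub>SL2C\<^esub> P ** P = mat 1"
    using group.l_inv[OF group_SL2C assms] by simp
  then show ?thesis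
    by (simp add: trace_mult_commute[of "P ** A"] matrix_mul_assoc)
qed

declare carrier_Gamma [simp del] SL2C_simps [simp del]

lemma conj_relI:
  assumes "\<rho> \<in> tau_reps \<tau>" "\<sigma> \<in> tau_reps \<tau>" "P \<in> carrier SL2C"
    and "\<And>g. g \<in> carrier \<Gamma> \<Longrightarrow> \<sigma> g = P \<otimes>\<^bsub>SL2C\<^esub> \<rho> g \<otimes>\<^bsub>SL2C\<^esub> inv\<^bsub>SL2C\<^esub> P"
  shows "(\<rho>, \<sigma>) \<in> conj_rel \<tau>"
  unfolding conj_rel_def using assms by (auto intro!: bexI[of _ P])

lemma conj_relE:
  assumes "(\<rho>, \<sigma>) \<in> conj_rel \<tau>"
  obtains P where "\<rho> \<in> tau_reps \<tau>" "\<sigma> \<in> tau_reps \<tau>" "P \<in> carrier SL2C"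
    and "\<forall>g\<in>carrier \<Gamma>. \<sigma> g = P \<otimes>\<^bsub>SL2C\<^esub> \<rho> g \<otimes>\<^bsub>SL2C\<^esub> inv\<^bsub>SL2C\<^esub> P"
proof -
  have "\<rho> \<in> tau_reps \<tau> \<and> \<sigma> \<in> tau_reps \<tau> \<and> (\<exists>P\<in>carrier SL2C. \<forall>g\<in>carrier \<Gamma>.
      \<sigma> g = P \<otimes>\<^bsub>SL2C\<^esub> \<rho> g \<otimes>\<^bsub>SL2C\<^esub> inv\<^bsub>SL2C\<^esub> P)"
    using assms by (simp add: conj_rel_def)
  then show thesis by (elim conjE bexE) (rule that)
qed

lemma equiv_conj_rel: "equiv (tau_reps \<tau>) (conj_rel \<tau>)"
proof (rule equivI)
  interpret S: group SL2C by (rule group_SL2C)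
  have cl: "\<rho> g \<in> carrier SL2C" if "\<rho> \<in> tau_reps \<tau>" "g \<in> carrier \<Gamma>" for \<rho> g
    using that unfolding tau_reps_def hom_def by blast
  show "conj_rel \<tau> \<subseteq> tau_reps \<tau> \<times> tau_reps \<tau>" by (auto simp: conj_rel_def)
  show "refl_on (tau_reps \<tau>) (conj_rel \<tau>)"
  proof (rule refl_onI)
    fix \<rho> assume r: "\<rho> \<in> tau_reps \<tau>"
    show "(\<rho>, \<rho>) \<in> conj_rel \<tau>"
      by (rule conj_relI[OF r r S.one_closed]) (simp add: cl[OF r])
  qed
  show "sym (conj_rel \<tau>)"
  proof (rule symI)
    fix \<rho> \<sigma> assume *: "(\<rho>, \<sigma>) \<in> conj_rel \<tau>"
    obtain P where r: "\<rho> \<in> tau_reps \<tau>" "\<sigma> \<in> tau_reps \<tau>" and P: "P \<in> carrier SL2C"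
      and s: "\<forall>g\<in>carrier \<Gamma>. \<sigma> g = P \<otimes>\<^bsub>SL2C\<^esub> \<rho> g \<otimes>\<^bsub>SL2C\<^esub> inv\<^bsub>SL2C\<^esub> P"
      by (rule conj_relE[OF *])
    have eq: "inv\<^bsub>SL2C\<^esub> P \<otimes>\<^bsub>SL2C\<^esub> (P \<otimes>\<^bsub>SL2C\<^esub> A) = A" if "A \<in> carrier SL2C" for A
      by (subst S.m_assoc[symmetric]) (use P that in simp_all)
    show "(\<sigma>, \<rho>) \<in> conj_rel \<tau>"
    proof (rule conj_relI[OF r(2,1) S.inv_closed[OF P]])
      fix g assume g: "g \<in> carrier \<Gamma>"
      show "\<rho> g = inv\<^bsub>SL2C\<^esub> P \<otimes>\<^bsub>SL2C\<^esub> \<sigma> g \<otimes>\<^bsub>SL2C\<^esub> inv\<^bsub>SL2C\<^esub> (inv\<^bsub>SL2C\<^esub> P)"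
        using P cl[OF r(1) g] by (simp add: bspec[OF s g] S.m_assoc eq)
    qed
  qed
  show "trans (conj_rel \<tau>)"
  proof (rule transI)
    fix \<rho> \<sigma> \<upsilon> assume *: "(\<rho>, \<sigma>) \<in> conj_rel \<tau>" "(\<sigma>, \<upsilon>) \<in> conj_rel \<tau>"
    obtain P where r: "\<rho> \<in> tau_reps \<tau>" "\<sigma> \<in> tau_reps \<tau>" and P: "P \<in> carrier SL2C"
      and s: "\<forall>g\<in>carrier \<Gamma>. \<sigma> g = P \<otimes>\<^bsub>SL2C\<^esub> \<rho> g \<otimes>\<^bsub>SL2C\<^esub> inv\<^bsub>SL2C\<^esub> P"
      by (rule conj_relE[OF *(1)])
    obtain Q where u: "\<sigma> \<in> tau_reps \<tau>" "\<upsilon> \<in> tau_reps \<tau>" and Q: "Q \<in> carrier SL2C"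
      and t: "\<forall>g\<in>carrier \<Gamma>. \<upsilon> g = Q \<otimes>\<^bsub>SL2C\<^esub> \<sigma> g \<otimes>\<^bsub>SL2C\<^esub> inv\<^bsub>SL2C\<^esub> Q"
      by (rule conj_relE[OF *(2)])
    show "(\<rho>, \<upsilon>) \<in> conj_rel \<tau>"
    proof (rule conj_relI[OF r(1) u(2) S.m_closed[OF Q P]])
      fix g assume g: "g \<in> carrier \<Gamma>"
      show "\<upsilon> g = Q \<otimes>\<^bsub>SL2C\<^esub> P \<otimes>\<^bsub>SL2C\<^esub> \<rho> g \<otimes>\<^bsub>SL2C\<^esub> inv\<^bsub>SL2C\<^esub> (Q \<otimes>\<^bsub>SL2C\<^esub> P)"
        using P Q cl[OF r(1) g] by (simp add: bspec[OF s g] bspec[OF t g] S.inv_mult_group S.m_assoc)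
    qed
  qed
qed

lemma tr_eq:
  assumes "c \<in> \<X> \<tau>" "\<rho> \<in> c" "g \<in> carrier \<Gamma>"
  shows "tr c g = trace (\<rho> g)"
proof -
  have "trace (\<sigma> g) = trace (\<rho> g)" if "\<sigma> \<in> c" for \<sigma>
  proof -
    have "(\<rho>, \<sigma>) \<in> conj_rel \<tau>"
      using quotient_eq_iff[OF equiv_conj_rel, of c \<tau> c \<rho> \<sigma>] assms(1,2) that by (simp add: \<X>_def)
    then obtain P where "\<rho> \<in> tau_reps \<tau>" "\<sigma> \<in> tau_reps \<tau>" and P: "P \<in> carrier SL2C"
      and s: "\<forall>g\<in>carrier \<Gamma>. \<sigma> g = P \<otimes>\<^bsub>SL2C\<^esub> \<rho> g \<otimes>\<^bsub>SL2C\<^esub> inv\<^bsub>SL2C\<^esub> P"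
      by (rule conj_relE)
    then show ?thesis
      using bspec[OF s assms(3)] trace_conj[OF P] by simp
  qed
  then show ?thesis
    unfolding tr_def using assms(2) by (intro the_elem_image_unique) blast+
qed


lemma comm_ab_closed: "comm_ab \<in> carrier \<Gamma>"
proof -
  interpret group \<Gamma> by (rule group_Gamma)
  have "elt_a \<in> carrier \<Gamma>" "elt_b \<in> carrier \<Gamma>" by (simp_all add: carrier_Gamma)
  then show ?thesis unfolding comm_ab_def by (intro m_closed inv_closed)
qed

lemma autoD:
  assumes "\<phi> \<in> auto \<Gamma>"
  shows "\<phi> \<in> hom \<Gamma> \<Gamma>" "\<phi> \<in> Bij (carrier \<Gamma>)" "\<phi> \<in> extensional (carrier \<Gamma>)"
    "\<And>g. g \<in> carrier \<Gamma> \<Longrightarrow> \<phi> g \<in> carrier \<Gamma>"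
  using assms unfolding auto_def hom_def Bij_def by blast+

lemma auto_conjugate:
  assumes "\<phi> \<in> auto \<Gamma>" "k \<in> carrier \<Gamma>" "g \<in> carrier \<Gamma>"
  shows "\<phi> (conjugate k g) = conjugate (\<phi> k) (\<phi> g)"
proof -
  interpret group_hom \<Gamma> \<Gamma> \<phi>
    using autoD[OF assms(1)] group_Gamma by (simp add: group_hom_def group_hom_axioms_def)
  show ?thesis
    using assms(2,3) unfolding conjugate_def
    by (simp only: hom_mult hom_inv G.m_closed G.inv_closed)
qed

lemma conjugate_closed:
  assumes "k \<in> carrier \<Gamma>" "g \<in> carrier \<Gamma>"
  shows "conjugate k g \<in> carrier \<Gamma>"
proof -
  interpret group \<Gamma> by (rule group_Gamma)
  show ?thesis using assms unfolding conjugate_def by (intro m_closed inv_closed)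
qed

lemma conjugate_conjugate:
  assumes "j \<in> carrier \<Gamma>" "k \<in> carrier \<Gamma>" "g \<in> carrier \<Gamma>"
  shows "conjugate j (conjugate k g) = conjugate (j \<otimes>\<^bsub>\<Gamma>\<^esub> k) g"
proof -
  interpret group \<Gamma> by (rule group_Gamma)
  show ?thesis
    using assms unfolding conjugate_def
    by (simp only: inv_mult_group m_assoc m_closed inv_closed)
qed

lemma conjugate_one:
  assumes "g \<in> carrier \<Gamma>"
  shows "conjugate \<one>\<^bsub>\<Gamma>\<^esub> g = g"
proof -
  interpret group \<Gamma> by (rule group_Gamma)
  show ?thesis using assms unfolding conjugate_def by (simp only: l_one r_one inv_one)
qed

lemma conjugate_mult:
  assumes "k \<in> carrier \<Gamma>" "g \<in> carrier \<Gamma>" "h \<in> carrier \<Gamma>"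
  shows "conjugate k (g \<otimes>\<^bsub>\<Gamma>\<^esub> h) = conjugate k g \<otimes>\<^bsub>\<Gamma>\<^esub> conjugate k h"
proof -
  interpret group \<Gamma> by (rule group_Gamma)
  have "inv\<^bsub>\<Gamma>\<^esub> k \<otimes>\<^bsub>\<Gamma>\<^esub> (k \<otimes>\<^bsub>\<Gamma>\<^esub> (h \<otimes>\<^bsub>\<Gamma>\<^esub> inv\<^bsub>\<Gamma>\<^esub> k)) = h \<otimes>\<^bsub>\<Gamma>\<^esub> inv\<^bsub>\<Gamma>\<^esub> k"
    using assms by (metis inv_closed l_inv l_one m_assoc m_closed)
  then show ?thesis
    using assms unfolding conjugate_def
    by (simp only: m_assoc m_closed inv_closed)
qed

lemma inner_compose:
  assumes "j \<in> carrier \<Gamma>" "k \<in> carrier \<Gamma>"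
  shows "compose (carrier \<Gamma>) (inner j) (inner k) = inner (j \<otimes>\<^bsub>\<Gamma>\<^esub> k)"
proof (rule ext)
  fix g
  show "compose (carrier \<Gamma>) (inner j) (inner k) g = inner (j \<otimes>\<^bsub>\<Gamma>\<^esub> k) g"
  proof (cases "g \<in> carrier \<Gamma>")
    case True
    then show ?thesis
      using conjugate_conjugate[OF assms True] conjugate_closed[OF assms(2) True]
      unfolding compose_def inner_def by simp
  qed (simp add: compose_def inner_def)
qed

lemma inner_auto:
  assumes "k \<in> carrier \<Gamma>"
  shows "inner k \<in> auto \<Gamma>"
proof -
  interpret group \<Gamma> by (rule group_Gamma)
  have i: "inv\<^bsub>\<Gamma>\<^esub> k \<in> carrier \<Gamma>" using assms by (rule inv_closed)
  have 1: "inner (inv\<^bsub>\<Gamma>\<^esub> k) (inner k g) = g" "inner k (inner (inv\<^bsub>\<Gamma>\<^esub> k) g) = g"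
    if g: "g \<in> carrier \<Gamma>" for g
    using g assms i conjugate_conjugate[OF i assms g] conjugate_conjugate[OF assms i g]
      conjugate_closed[OF assms g] conjugate_closed[OF i g] conjugate_one[OF g]
    unfolding inner_def by simp_all
  have cl: "inner j g \<in> carrier \<Gamma>" if "j \<in> carrier \<Gamma>" "g \<in> carrier \<Gamma>" for j g
    using that conjugate_closed[OF that] by (simp add: inner_def)
  have "bij_betw (inner k) (carrier \<Gamma>) (carrier \<Gamma>)"
    by (rule bij_betw_byWitness[where f' = "inner (inv\<^bsub>\<Gamma>\<^esub> k)"])
       (use 1 cl assms i in \<open>auto\<close>)
  moreover have "inner k \<in> hom \<Gamma> \<Gamma>"
    using cl[OF assms] conjugate_mult[OF assms]
    by (auto simp: hom_def inner_def)
  ultimately show ?thesis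
    by (auto simp: auto_def Bij_def inner_def)
qed

lemma AutoGroup_simps:
  "carrier (AutoGroup \<Gamma>) = auto \<Gamma>"
  "\<phi> \<in> auto \<Gamma> \<Longrightarrow> \<psi> \<in> auto \<Gamma> \<Longrightarrow> \<phi> \<otimes>\<^bsub>AutoGroup \<Gamma>\<^esub> \<psi> = compose (carrier \<Gamma>) \<phi> \<psi>"
  "\<one>\<^bsub>AutoGroup \<Gamma>\<^esub> = (\<lambda>g\<in>carrier \<Gamma>. g)"
  by (auto simp: AutoGroup_def BijGroup_def auto_def)

lemma subgroup_Aut_plus: "subgroup Aut_plus (AutoGroup \<Gamma>)"
proof -
  interpret G: group \<Gamma> by (rule group_Gamma)
  interpret A: group "AutoGroup \<Gamma>" by (rule G.AutoGroup)
  note c = comm_ab_closed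
  show ?thesis
  proof (rule A.subgroupI)
    show "Aut_plus \<subseteq> carrier (AutoGroup \<Gamma>)"
      by (auto simp: Aut_plus_def AutoGroup_simps)
    have "(\<lambda>g\<in>carrier \<Gamma>. g) \<in> auto \<Gamma>" by (rule G.id_in_auto)
    then have "(\<lambda>g\<in>carrier \<Gamma>. g) \<in> Aut_plus"
      using conjugate_one[OF c] G.one_closed restrict_apply'[OF c, of "\<lambda>g. g"]
      unfolding Aut_plus_def by (auto simp del: restrict_apply intro!: bexI[of _ "\<one>\<^bsub>\<Gamma>\<^esub>"])
    then show "Aut_plus \<noteq> {}" by blast
  next
    fix \<phi> assume p: "\<phi> \<in> Aut_plus"
    then have pa: "\<phi> \<in> auto \<Gamma>" by (simp add: Aut_plus_def)
    define \<psi> where "\<psi> = inv\<^bsub>AutoGroup \<Gamma>\<^esub> \<phi>"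
    have q: "\<psi> \<in> auto \<Gamma>"
      using A.inv_closed[of \<phi>] pa by (simp add: \<psi>_def AutoGroup_simps)
    have "compose (carrier \<Gamma>) \<psi> \<phi> = (\<lambda>g\<in>carrier \<Gamma>. g)"
      using A.l_inv[of \<phi>, unfolded AutoGroup_simps, OF pa] AutoGroup_simps(2)[OF q pa]
      by (simp add: \<psi>_def AutoGroup_simps(3))
    then have inv: "\<psi> (\<phi> g) = g" if "g \<in> carrier \<Gamma>" for g
      using that by (metis compose_eq restrict_apply')
    obtain k where k: "k \<in> carrier \<Gamma>" "\<phi> comm_ab = conjugate k comm_ab"
      using p by (auto simp: Aut_plus_def)
    have pk: "\<psi> k \<in> carrier \<Gamma>" "\<psi> comm_ab \<in> carrier \<Gamma>" "inv\<^bsub>\<Gamma>\<^esub> \<psi> k \<in> carrier \<Gamma>"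
      using autoD(4)[OF q] k(1) c G.inv_closed by blast+
    have "comm_ab = conjugate (\<psi> k) (\<psi> comm_ab)"
      using inv[OF c] k auto_conjugate[OF q k(1) c] by simp
    then have "conjugate (inv\<^bsub>\<Gamma>\<^esub> \<psi> k) comm_ab = \<psi> comm_ab"
      using conjugate_conjugate[OF pk(3,1,2)] conjugate_one[OF pk(2)] G.l_inv[OF pk(1)] by simp
    then show "inv\<^bsub>AutoGroup \<Gamma>\<^esub> \<phi> \<in> Aut_plus"
      using q pk(3) unfolding Aut_plus_def \<psi>_def[symmetric]
      by (auto intro!: bexI[of _ "inv\<^bsub>\<Gamma>\<^esub> \<psi> k"])
  next
    fix \<phi> \<psi> assume p: "\<phi> \<in> Aut_plus" "\<psi> \<in> Aut_plus"
    then have a: "\<phi> \<in> auto \<Gamma>" "\<psi> \<in> auto \<Gamma>" by (auto simp: Aut_plus_def)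
    obtain j where j: "j \<in> carrier \<Gamma>" "\<phi> comm_ab = conjugate j comm_ab"
      using p by (auto simp: Aut_plus_def)
    obtain k where k: "k \<in> carrier \<Gamma>" "\<psi> comm_ab = conjugate k comm_ab"
      using p by (auto simp: Aut_plus_def)
    have cl: "\<phi> k \<in> carrier \<Gamma>" using autoD(4)[OF a(1) k(1)] .
    have "(\<phi> \<otimes>\<^bsub>AutoGroup \<Gamma>\<^esub> \<psi>) comm_ab = conjugate (\<phi> k \<otimes>\<^bsub>\<Gamma>\<^esub> j) comm_ab"
      using c j k auto_conjugate[OF a(1) k(1) c] conjugate_conjugate[OF cl j(1) c]
      by (simp add: AutoGroup_simps a compose_eq)
    moreover have "\<phi> \<otimes>\<^bsub>AutoGroup \<Gamma>\<^esub> \<psi> \<in> auto \<Gamma>"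
      using A.m_closed[of \<phi> \<psi>] a by (simp add: AutoGroup_simps(1))
    ultimately show "\<phi> \<otimes>\<^bsub>AutoGroup \<Gamma>\<^esub> \<psi> \<in> Aut_plus"
      using G.m_closed[OF cl j(1)] unfolding Aut_plus_def by blast
  qed
qed

lemma Inner_normal: "Inner \<lhd> (AutoGroup \<Gamma>)\<lparr>carrier := Aut_plus\<rparr>"
proof -
  interpret G: group \<Gamma> by (rule group_Gamma)
  interpret A: group "AutoGroup \<Gamma>" by (rule G.AutoGroup)
  let ?P = "(AutoGroup \<Gamma>)\<lparr>carrier := Aut_plus\<rparr>"
  interpret P: group ?P by (rule A.subgroup_imp_group[OF subgroup_Aut_plus])
  have plus: "inner k \<in> Aut_plus" if "k \<in> carrier \<Gamma>" for k
    using inner_auto[OF that] that comm_ab_closed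
    by (auto simp: Aut_plus_def inner_def)
  have "group_hom \<Gamma> ?P inner"
    using plus inner_compose inner_auto G.is_group P.is_group
    by (auto simp: group_hom_def group_hom_axioms_def hom_def AutoGroup_simps)
  then have "subgroup Inner ?P"
    unfolding Inner_def by (rule group_hom.img_is_subgroup)
  moreover have "\<phi> \<otimes>\<^bsub>?P\<^esub> f \<otimes>\<^bsub>?P\<^esub> inv\<^bsub>?P\<^esub> \<phi> \<in> Inner" if phi: "\<phi> \<in> carrier ?P" and f: "f \<in> Inner" for \<phi> f
  proof -
    obtain k where k: "k \<in> carrier \<Gamma>" "f = inner k" using f Inner_def by blast
    have p: "\<phi> \<in> Aut_plus" using phi by simp
    then have a: "\<phi> \<in> auto \<Gamma>" by (simp add: Aut_plus_def)
    have fk: "\<phi> k \<in> carrier \<Gamma>" using autoD(4)[OF a k(1)] .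
    have "compose (carrier \<Gamma>) \<phi> (inner k) = compose (carrier \<Gamma>) (inner (\<phi> k)) \<phi>"
      using auto_conjugate[OF a k(1)] autoD(4)[OF a]
      by (auto simp: compose_def inner_def fun_eq_iff)
    then have "\<phi> \<otimes>\<^bsub>?P\<^esub> f = inner (\<phi> k) \<otimes>\<^bsub>?P\<^esub> \<phi>"
      using a inner_auto[OF k(1)] inner_auto[OF fk] k(2) by (simp add: AutoGroup_simps)
    then have "\<phi> \<otimes>\<^bsub>?P\<^esub> f \<otimes>\<^bsub>?P\<^esub> inv\<^bsub>?P\<^esub> \<phi> = inner (\<phi> k)"
      using P.inv_solve_right'[of "inner (\<phi> k)" "inner (\<phi> k) \<otimes>\<^bsub>?P\<^esub> \<phi>" \<phi>] plus[OF fk] phi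
        P.m_closed[of "inner (\<phi> k)" \<phi>]
      by simp
    then show ?thesis using fk Inner_def by blast
  qed
  ultimately show ?thesis by (rule P.normal_invI)
qed

lemma group_MCG: "group MCG"
  unfolding MCG_def by (rule normal.factorgroup_is_group[OF Inner_normal])

lemma MCG_cosets:
  assumes "H \<in> carrier MCG"
  obtains \<phi> where "\<phi> \<in> Aut_plus"
    "H = {compose (carrier \<Gamma>) (inner k) \<phi> | k. k \<in> carrier \<Gamma>}"
proof -
  obtain \<phi> where p: "\<phi> \<in> Aut_plus" "H = Inner #>\<^bsub>(AutoGroup \<Gamma>)\<lparr>carrier := Aut_plus\<rparr>\<^esub> \<phi>"
    using assms by (auto simp: MCG_def FactGroup_def RCOSETS_def)
  have "\<phi> \<in> auto \<Gamma>" using p(1) by (simp add: Aut_plus_def)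
  then have "H = {compose (carrier \<Gamma>) (inner k) \<phi> | k. k \<in> carrier \<Gamma>}"
    using p(2) inner_auto unfolding Inner_def r_coset_def
    by (auto simp: AutoGroup_simps)
  with p(1) that show thesis by blast
qed

lemma tau_reps_compose:
  assumes "\<rho> \<in> tau_reps \<tau>" "\<phi> \<in> Aut_plus"
  shows "compose (carrier \<Gamma>) \<rho> \<phi> \<in> tau_reps \<tau>"
proof -
  have a: "\<phi> \<in> auto \<Gamma>" using assms(2) by (simp add: Aut_plus_def)
  have r: "\<rho> \<in> hom \<Gamma> SL2C" "trace (\<rho> comm_ab) = \<tau>"
    using assms(1) by (auto simp: tau_reps_def)
  interpret group_hom \<Gamma> SL2C \<rho>
    using r group_Gamma group_SL2C by (simp add: group_hom_def group_hom_axioms_def)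
  obtain k where k: "k \<in> carrier \<Gamma>" "\<phi> comm_ab = conjugate k comm_ab"
    using assms(2) by (auto simp: Aut_plus_def)
  note c = comm_ab_closed
  have "\<rho> (conjugate k comm_ab) = \<rho> k \<otimes>\<^bsub>SL2C\<^esub> \<rho> comm_ab \<otimes>\<^bsub>SL2C\<^esub> inv\<^bsub>SL2C\<^esub> \<rho> k"
    using k(1) c unfolding conjugate_def by (simp only: hom_mult hom_inv G.m_closed G.inv_closed)
  then have "trace (compose (carrier \<Gamma>) \<rho> \<phi> comm_ab) = \<tau>"
    using k(2) r(2) c trace_conj[OF hom_closed[OF k(1)]] by (simp add: compose_eq)
  moreover have "compose (carrier \<Gamma>) \<rho> \<phi> \<in> hom \<Gamma> SL2C"
    by (rule G.hom_compose[OF autoD(1)[OF a] r(1)])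
  ultimately show ?thesis by (auto simp: tau_reps_def compose_def)
qed

lemma mcg_act_class:
  assumes "\<rho> \<in> tau_reps \<tau>" "H \<in> carrier MCG" "\<phi> \<in> H"
  shows "mcg_act H (conj_rel \<tau> `` {\<rho>}) = conj_rel \<tau> `` {compose (carrier \<Gamma>) \<rho> \<phi>}"
    and "compose (carrier \<Gamma>) \<rho> \<phi> \<in> tau_reps \<tau>"
proof -
  interpret G: group \<Gamma> by (rule group_Gamma)
  interpret A: group "AutoGroup \<Gamma>" by (rule G.AutoGroup)
  interpret S: group SL2C by (rule group_SL2C)
  let ?P = "(AutoGroup \<Gamma>)\<lparr>carrier := Aut_plus\<rparr>"
  interpret N: normal Inner ?P by (rule Inner_normal)
  have H: "H \<in> rcosets\<^bsub>?P\<^esub> Inner" using assms(2) by (simp add: MCG_def FactGroup_def)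
  have sub: "\<psi> \<in> Aut_plus" if "\<psi> \<in> H" for \<psi>
    using that N.rcosets_carrier[OF N.is_group H] by auto
  have *: "compose (carrier \<Gamma>) \<rho> \<psi> \<in> tau_reps \<tau>" if "\<rho> \<in> tau_reps \<tau>" "\<psi> \<in> H" for \<rho> \<psi>
    using tau_reps_compose[OF that(1) sub[OF that(2)]] .
  then show "compose (carrier \<Gamma>) \<rho> \<phi> \<in> tau_reps \<tau>" using assms by blast
  show "mcg_act H (conj_rel \<tau> `` {\<rho>}) = conj_rel \<tau> `` {compose (carrier \<Gamma>) \<rho> \<phi>}"
  proof (intro equalityI subsetI)
    fix \<sigma> assume "\<sigma> \<in> mcg_act H (conj_rel \<tau> `` {\<rho>})"
    then obtain \<rho>' \<psi> where s: "\<sigma> = compose (carrier \<Gamma>) \<rho>' \<psi>" "(\<rho>, \<rho>') \<in> conj_rel \<tau>" "\<psi> \<in> H"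
      by (auto simp: mcg_act_def)
    obtain P where "\<rho> \<in> tau_reps \<tau>" and rt: "\<rho>' \<in> tau_reps \<tau>" and P: "P \<in> carrier SL2C"
      and r': "\<forall>g\<in>carrier \<Gamma>. \<rho>' g = P \<otimes>\<^bsub>SL2C\<^esub> \<rho> g \<otimes>\<^bsub>SL2C\<^esub> inv\<^bsub>SL2C\<^esub> P"
      by (rule conj_relE[OF s(2)])
    have r: "\<rho> \<in> hom \<Gamma> SL2C" using assms(1) by (simp add: tau_reps_def)
    interpret R: group_hom \<Gamma> SL2C \<rho>
      using r group_Gamma group_SL2C by (simp add: group_hom_def group_hom_axioms_def)
    obtain \<phi>\<^sub>0 where p0: "\<phi>\<^sub>0 \<in> Aut_plus"
      "H = {compose (carrier \<Gamma>) (inner k) \<phi>\<^sub>0 | k. k \<in> carrier \<Gamma>}"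
      using MCG_cosets[OF assms(2)] by blast
    then have p0a: "\<phi>\<^sub>0 \<in> auto \<Gamma>" by (simp add: Aut_plus_def)
    obtain j where j: "j \<in> carrier \<Gamma>" "\<phi> = compose (carrier \<Gamma>) (inner j) \<phi>\<^sub>0"
      using assms(3) p0(2) by blast
    obtain k where k: "k \<in> carrier \<Gamma>" "\<psi> = compose (carrier \<Gamma>) (inner k) \<phi>\<^sub>0"
      using s(3) p0(2) by blast
    define h where "h = k \<otimes>\<^bsub>\<Gamma>\<^esub> inv\<^bsub>\<Gamma>\<^esub> j"
    have h: "h \<in> carrier \<Gamma>" "k = h \<otimes>\<^bsub>\<Gamma>\<^esub> j"
      using j(1) k(1) unfolding h_def by (metis G.inv_closed G.m_closed, metis G.inv_closed G.l_inv G.m_assoc G.r_one)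
    have pc: "\<phi> g \<in> carrier \<Gamma>" if "g \<in> carrier \<Gamma>" for g
      using autoD(4)[of \<phi>] sub[OF assms(3)] that by (simp add: Aut_plus_def)
    have psi: "\<psi> g = conjugate h (\<phi> g)" if g: "g \<in> carrier \<Gamma>" for g
      using j k(2) h g autoD(4)[OF p0a g] conjugate_conjugate[OF h(1) j(1) autoD(4)[OF p0a g]]
      by (simp add: compose_eq inner_def)
    let ?Q = "P \<otimes>\<^bsub>SL2C\<^esub> \<rho> h"
    have Q: "?Q \<in> carrier SL2C" by (rule S.m_closed[OF P R.hom_closed[OF h(1)]])
    have "\<sigma> g = ?Q \<otimes>\<^bsub>SL2C\<^esub> compose (carrier \<Gamma>) \<rho> \<phi> g \<otimes>\<^bsub>SL2C\<^esub> inv\<^bsub>SL2C\<^esub> ?Q" if g: "g \<in> carrier \<Gamma>" for g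
    proof -
      have "\<sigma> g = P \<otimes>\<^bsub>SL2C\<^esub> \<rho> (conjugate h (\<phi> g)) \<otimes>\<^bsub>SL2C\<^esub> inv\<^bsub>SL2C\<^esub> P"
        using r' s(1) psi[OF g] conjugate_closed[OF h(1) pc[OF g]] by (simp add: compose_eq[OF g])
      also have "\<rho> (conjugate h (\<phi> g)) = \<rho> h \<otimes>\<^bsub>SL2C\<^esub> \<rho> (\<phi> g) \<otimes>\<^bsub>SL2C\<^esub> inv\<^bsub>SL2C\<^esub> \<rho> h"
        using h(1) pc[OF g] unfolding conjugate_def
        by (simp only: R.hom_mult R.hom_inv G.m_closed G.inv_closed)
      also have "P \<otimes>\<^bsub>SL2C\<^esub> (\<rho> h \<otimes>\<^bsub>SL2C\<^esub> \<rho> (\<phi> g) \<otimes>\<^bsub>SL2C\<^esub> inv\<^bsub>SL2C\<^esub> \<rho> h) \<otimes>\<^bsub>SL2C\<^esub> inv\<^bsub>SL2C\<^esub> P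
          = ?Q \<otimes>\<^bsub>SL2C\<^esub> \<rho> (\<phi> g) \<otimes>\<^bsub>SL2C\<^esub> inv\<^bsub>SL2C\<^esub> ?Q"
        using P R.hom_closed[OF h(1)] R.hom_closed[OF pc[OF g]]
        by (simp only: S.inv_mult_group S.m_assoc S.m_closed S.inv_closed)
      finally show ?thesis by (simp only: compose_eq[OF g])
    qed
    then have "(compose (carrier \<Gamma>) \<rho> \<phi>, \<sigma>) \<in> conj_rel \<tau>"
      using *[OF rt s(3)] s(1) by (intro conj_relI[OF *[OF assms(1,3)] _ Q]) simp_all
    then show "\<sigma> \<in> conj_rel \<tau> `` {compose (carrier \<Gamma>) \<rho> \<phi>}" by simp
  next
    fix \<sigma> assume "\<sigma> \<in> conj_rel \<tau> `` {compose (carrier \<Gamma>) \<rho> \<phi>}"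
    then have s0: "(compose (carrier \<Gamma>) \<rho> \<phi>, \<sigma>) \<in> conj_rel \<tau>" by simp
    obtain P where "compose (carrier \<Gamma>) \<rho> \<phi> \<in> tau_reps \<tau>" and st: "\<sigma> \<in> tau_reps \<tau>"
      and P: "P \<in> carrier SL2C"
      and s: "\<forall>g\<in>carrier \<Gamma>. \<sigma> g = P \<otimes>\<^bsub>SL2C\<^esub> compose (carrier \<Gamma>) \<rho> \<phi> g \<otimes>\<^bsub>SL2C\<^esub> inv\<^bsub>SL2C\<^esub> P"
      by (rule conj_relE[OF s0])
    define \<rho>' where "\<rho>' = (\<lambda>g\<in>carrier \<Gamma>. P \<otimes>\<^bsub>SL2C\<^esub> \<rho> g \<otimes>\<^bsub>SL2C\<^esub> inv\<^bsub>SL2C\<^esub> P)"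
    have r: "\<rho> \<in> hom \<Gamma> SL2C" "trace (\<rho> comm_ab) = \<tau>" using assms(1) by (auto simp: tau_reps_def)
    interpret R: group_hom \<Gamma> SL2C \<rho>
      using r group_Gamma group_SL2C by (simp add: group_hom_def group_hom_axioms_def)
    have "\<rho>' \<in> hom \<Gamma> SL2C"
    proof (rule homI)
      fix x y assume x: "x \<in> carrier \<Gamma>" and y: "y \<in> carrier \<Gamma>"
      have eq: "A = inv\<^bsub>SL2C\<^esub> P \<otimes>\<^bsub>SL2C\<^esub> (P \<otimes>\<^bsub>SL2C\<^esub> A)" if "A \<in> carrier SL2C" for A
        using that P by (metis S.inv_closed S.l_inv S.l_one S.m_assoc)
      have "P \<otimes>\<^bsub>SL2C\<^esub> \<rho> (x \<otimes>\<^bsub>\<Gamma>\<^esub> y) \<otimes>\<^bsub>SL2C\<^esub> inv\<^bsub>SL2C\<^esub> P = P \<otimes>\<^bsub>SL2C\<^esub> \<rho> x \<otimes>\<^bsub>SL2C\<^esub> inv\<^bsub>SL2C\<^esub> P \<otimes>\<^bsub>SL2C\<^esub>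
         (P \<otimes>\<^bsub>SL2C\<^esub> \<rho> y \<otimes>\<^bsub>SL2C\<^esub> inv\<^bsub>SL2C\<^esub> P)"
        using P R.hom_closed[OF x] R.hom_closed[OF y] eq[of "\<rho> y \<otimes>\<^bsub>SL2C\<^esub> inv\<^bsub>SL2C\<^esub> P"]
        by (metis R.hom_mult S.inv_closed S.m_assoc S.m_closed x y)
      then show "\<rho>' (x \<otimes>\<^bsub>\<Gamma>\<^esub> y) = \<rho>' x \<otimes>\<^bsub>SL2C\<^esub> \<rho>' y"
        using x y G.m_closed[OF x y] by (simp only: \<rho>'_def restrict_apply')
    next
      fix x assume x: "x \<in> carrier \<Gamma>"
      then show "\<rho>' x \<in> carrier SL2C"
        using P R.hom_closed[OF x] S.m_closed S.inv_closed by (simp only: \<rho>'_def restrict_apply')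
    qed
    moreover have "trace (\<rho>' comm_ab) = \<tau>"
      using trace_conj[OF P] r(2) comm_ab_closed by (simp only: \<rho>'_def restrict_apply')
    ultimately have "\<rho>' \<in> tau_reps \<tau>" by (auto simp: tau_reps_def \<rho>'_def)
    then have "(\<rho>, \<rho>') \<in> conj_rel \<tau>"
      using assms(1) P by (intro conj_relI) (simp_all add: \<rho>'_def)
    moreover have "\<sigma> = compose (carrier \<Gamma>) \<rho>' \<phi>"
    proof (rule extensionalityI)
      show "\<sigma> \<in> extensional (carrier \<Gamma>)" using st by (simp add: tau_reps_def)
      fix g assume g: "g \<in> carrier \<Gamma>"
      have "\<phi> g \<in> carrier \<Gamma>"
        using autoD(4)[of \<phi>] sub[OF assms(3)] g by (simp add: Aut_plus_def)
      then show "\<sigma> g = compose (carrier \<Gamma>) \<rho>' \<phi> g"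
        using s g by (simp only: \<rho>'_def compose_eq restrict_apply')
    qed (simp add: compose_def)
    ultimately show "\<sigma> \<in> mcg_act H (conj_rel \<tau> `` {\<rho>})"
      using assms(3) unfolding mcg_act_def by blast
  qed
qed

lemma free_basis_ab: "free_basis elt_a elt_b"
proof -
  interpret group \<Gamma> by (rule group_Gamma)
  have "(\<lambda>w. w) \<in> hom \<Gamma> \<Gamma>" by (simp add: hom_def)
  then have "word_eval \<Gamma> elt_a elt_b w = w" if "w \<in> carrier \<Gamma>" for w
    using hom_eq_word_eval[OF group_Gamma _ that, of "\<lambda>w. w"] by simp
  then show ?thesis
    by (auto simp: free_basis_def carrier_Gamma bij_betw_def inj_on_def image_iff)
qed

lemma inv_SL2C:
  assumes "A \<in> carrier SL2C"
  shows "inv\<^bsub>SL2C\<^esub> A = vector [vector [A$2$2, - A$1$2], vector [- A$2$1, A$1$1]]" (is "_ = ?B")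
proof (rule group.inv_equality[OF group_SL2C _ assms])
  have "det A = 1" using assms by (simp add: SL2C_simps)
  then show "?B \<otimes>\<^bsub>SL2C\<^esub> A = \<one>\<^bsub>SL2C\<^esub>" "?B \<in> carrier SL2C"
    by (simp_all add: SL2C_simps det_2 vec_eq_iff forall_2 matrix_matrix_mult_def sum_2 mat_def
        algebra_simps)
qed

lemma trace_commutator:
  assumes "A \<in> carrier SL2C" "B \<in> carrier SL2C"
  defines "x \<equiv> trace A" and "y \<equiv> trace B" and "z \<equiv> trace (A \<otimes>\<^bsub>SL2C\<^esub> B)"
  shows "trace (A \<otimes>\<^bsub>SL2C\<^esub> B \<otimes>\<^bsub>SL2C\<^esub> inv\<^bsub>SL2C\<^esub> A \<otimes>\<^bsub>SL2C\<^esub> inv\<^bsub>SL2C\<^esub> B) = x\<^sup>2 + y\<^sup>2 + z\<^sup>2 - x * y * z - 2"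
proof -
  have "trace (A \<otimes>\<^bsub>SL2C\<^esub> B \<otimes>\<^bsub>SL2C\<^esub> inv\<^bsub>SL2C\<^esub> A \<otimes>\<^bsub>SL2C\<^esub> inv\<^bsub>SL2C\<^esub> B)
      = x\<^sup>2 * det B + y\<^sup>2 * det A + z\<^sup>2 - x * y * z - 2 * det A * det B"
    unfolding inv_SL2C[OF assms(1)] inv_SL2C[OF assms(2)]
    by (simp add: x_def y_def z_def SL2C_simps det_2 trace_def
        matrix_matrix_mult_def sum_2 power2_eq_square algebra_simps)
  then show ?thesis using assms(1,2) by (simp add: SL2C_simps)
qed

lemma trace_coords_surface:
  assumes "c \<in> \<X> \<tau>"
  shows "trace_coords c \<in> cubic_surface \<tau>"
proof -
  obtain \<rho> where r: "\<rho> \<in> tau_reps \<tau>" "\<rho> \<in> c"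
    using assms equiv_class_self[OF equiv_conj_rel] unfolding \<X>_def by (blast elim: quotientE)
  interpret group_hom \<Gamma> SL2C \<rho>
    using r(1) group_Gamma group_SL2C by (simp add: group_hom_def group_hom_axioms_def tau_reps_def)
  have cl: "elt_a \<in> carrier \<Gamma>" "elt_b \<in> carrier \<Gamma>" by (simp_all add: carrier_Gamma)
  have "\<rho> comm_ab = \<rho> elt_a \<otimes>\<^bsub>SL2C\<^esub> \<rho> elt_b \<otimes>\<^bsub>SL2C\<^esub> inv\<^bsub>SL2C\<^esub> \<rho> elt_a \<otimes>\<^bsub>SL2C\<^esub> inv\<^bsub>SL2C\<^esub> \<rho> elt_b"
    unfolding comm_ab_def using cl by (simp only: hom_mult hom_inv G.m_closed G.inv_closed)
  then have "\<tau> = trace (\<rho> elt_a \<otimes>\<^bsub>SL2C\<^esub> \<rho> elt_b \<otimes>\<^bsub>SL2C\<^esub> inv\<^bsub>SL2C\<^esub> \<rho> elt_a \<otimes>\<^bsub>SL2C\<^esub> inv\<^bsub>SL2C\<^esub> \<rho> elt_b)"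
    using r(1) by (simp add: tau_reps_def)
  then show ?thesis
    using trace_commutator[OF hom_closed[OF cl(1)] hom_closed[OF cl(2)]] hom_mult[OF cl]
    by (simp add: trace_coords_def cubic_surface_def tr_eq[OF assms r(2)] cl G.m_closed)
qed

lemma topspace_X_topology: "topspace (X_topology \<tau>) = \<X> \<tau>"
  using trace_coords_surface by (auto simp: X_topology_def topspace_pullback_topology)

end

theory Submission
  imports Defs "HOL-Library.Sublist" "HOL-Algebra.Elementary_Groups"
begin

text \<open>
  The coordinates of a translate of \<open>\<rho>\<close> under a mapping class are \<open>(tr \<rho>(u), tr \<rho>(v), tr \<rho>(u v))\<close>, where
  \<open>(u, v)\<close> is the positively oriented free basis to which the mapping class sends \<open>(a, b)\<close>, and bases
  that differ by more than a simultaneous conjugation come from distinct mapping classes.  The cubic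
  surface is closed in \<open>\<complex>\<^sup>3\<close> and each of its points is the coordinate triple of a representation, so by
  the Bolzano--Weierstrass theorem it suffices to find infinitely many such bases whose trace triples
  stay bounded (\<open>bounded_orbit_converges\<close>).

  If \<open>tr \<rho>(u) = x\<close> lies in the real interval \<open>(-2, 2)\<close>, the Dehn twists along \<open>u\<close> give the bases
  \<open>(u, u\<^sup>n w)\<close>.  The traces \<open>y\<^sub>n\<close> of \<open>u\<^sup>n w\<close> satisfy \<open>y\<^sub>n\<^sub>+\<^sub>2 = x y\<^sub>n\<^sub>+\<^sub>1 - y\<^sub>n\<close>, a recursion by an elliptic
  matrix, which preserves a definite Hermitian form; hence they are bounded
  (\<open>elliptic_recurrence_bounded\<close>).

  If infinitely many curves have traces of modulus at most \<open>2\<close>, call these curves small.  Every small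
  curve \<open>u\<close> has a small Farey neighbour \<open>w\<close>, that is, one that forms a basis with \<open>u\<close>
  (\<open>small_neighbour\<close>).  The two small traces bound the third coordinate through the equation of the
  surface, so every small curve contributes a basis with a bounded trace triple.  The reason for the
  existence of \<open>w\<close> is Bowditch's: suppose that all the neighbours of \<open>u\<close> have traces of modulus greater
  than \<open>2\<close>.  Walking away from \<open>u\<close> through the Farey tessellation, one crosses an edge \<open>{p, q}\<close> from the
  vertex \<open>p q\<inverse>\<close> to the vertex \<open>p q\<close>, whose traces add up to \<open>tr \<rho>(p) tr \<rho>(q)\<close>, and by induction the
  moduli of the traces never decrease (\<open>outer_large\<close>).  So all curves other than \<open>u\<close> would have traces of modulus
  greater than \<open>2\<close>.

  What relates arbitrary free bases to this picture is Nielsen's theorem: every basis is obtained from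
  \<open>(a, b)\<close> by elementary moves (\<open>free_basis_nielsen\<close>).  It shows that a basis can be oriented
  (\<open>free_basis_oriented\<close>) and that it is an edge reached by an outward walk from \<open>a\<close>
  (\<open>free_basis_edge\<close>).
\<close>

section \<open>Free bases\<close>

interpretation \<Gamma>: group \<Gamma>
  by (rule group_Gamma)

lemma ab_closed [simp]: "elt_a \<in> carrier \<Gamma>" "elt_b \<in> carrier \<Gamma>"
  by (simp_all add: carrier_Gamma)

lemma mult_cancel_left_inv:
  assumes "x \<in> carrier \<Gamma>" "y \<in> carrier \<Gamma>"
  shows "inv\<^bsub>\<Gamma>\<^esub> x \<otimes>\<^bsub>\<Gamma>\<^esub> (x \<otimes>\<^bsub>\<Gamma>\<^esub> y) = y" "x \<otimes>\<^bsub>\<Gamma>\<^esub> (inv\<^bsub>\<Gamma>\<^esub> x \<otimes>\<^bsub>\<Gamma>\<^esub> y) = y"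
  using assms by (simp_all flip: \<Gamma>.m_assoc)

text \<open>
  Right-associated words with cancelled adjacent inverses are normal forms, so rewriting with these
  rules proves the identities of elements of the group that hold in every group.
\<close>

lemmas free_simps = \<Gamma>.m_assoc \<Gamma>.inv_mult_group mult_cancel_left_inv conjugate_def

lemma conjugate_in_carrier [simp]:
  "k \<in> carrier \<Gamma> \<Longrightarrow> g \<in> carrier \<Gamma> \<Longrightarrow> conjugate k g \<in> carrier \<Gamma>"
  by (rule conjugate_closed)

lemma hom_Gamma_eqI:
  assumes "group G" "f \<in> hom \<Gamma> G" "g \<in> hom \<Gamma> G" "f elt_a = g elt_a" "f elt_b = g elt_b"
    and "x \<in> carrier \<Gamma>"
  shows "f x = g x"
  using hom_eq_word_eval[of G f x] hom_eq_word_eval[of G g x] assms by simp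

lemma hom_Gamma_simps:
  assumes "group G" "f \<in> hom \<Gamma> G" "x \<in> carrier \<Gamma>"
  shows "y \<in> carrier \<Gamma> \<Longrightarrow> f (x \<otimes>\<^bsub>\<Gamma>\<^esub> y) = f x \<otimes>\<^bsub>G\<^esub> f y" "f (inv\<^bsub>\<Gamma>\<^esub> x) = inv\<^bsub>G\<^esub> f x" "f x \<in> carrier G"
proof -
  interpret group_hom \<Gamma> G f
    using assms group_Gamma by (simp add: group_hom_def group_hom_axioms_def)
  show "y \<in> carrier \<Gamma> \<Longrightarrow> f (x \<otimes>\<^bsub>\<Gamma>\<^esub> y) = f x \<otimes>\<^bsub>G\<^esub> f y" "f (inv\<^bsub>\<Gamma>\<^esub> x) = inv\<^bsub>G\<^esub> f x" "f x \<in> carrier G"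
    using assms by simp_all
qed

lemma auto_simps:
  assumes "\<phi> \<in> auto \<Gamma>" "x \<in> carrier \<Gamma>"
  shows "y \<in> carrier \<Gamma> \<Longrightarrow> \<phi> (x \<otimes>\<^bsub>\<Gamma>\<^esub> y) = \<phi> x \<otimes>\<^bsub>\<Gamma>\<^esub> \<phi> y" "\<phi> (inv\<^bsub>\<Gamma>\<^esub> x) = inv\<^bsub>\<Gamma>\<^esub> \<phi> x" "\<phi> x \<in> carrier \<Gamma>"
  using hom_Gamma_simps[OF group_Gamma autoD(1)[OF assms(1)] assms(2)] by simp_all

lemma free_basis_iff_auto:
  "free_basis u v \<longleftrightarrow> (\<exists>\<phi>\<in>auto \<Gamma>. \<phi> elt_a = u \<and> \<phi> elt_b = v)"
proof
  assume uv: "free_basis u v"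
  then have cl: "u \<in> carrier \<Gamma>" "v \<in> carrier \<Gamma>" by (simp_all add: free_basis_def)
  let ?f = "restrict (word_eval \<Gamma> u v) (carrier \<Gamma>)"
  have "?f \<in> hom \<Gamma> \<Gamma>"
    using word_eval_hom[OF group_Gamma cl] by (auto simp: hom_def)
  moreover have "bij_betw ?f (carrier \<Gamma>) (carrier \<Gamma>)"
    using uv unfolding free_basis_def carrier_Gamma[symmetric] by (simp cong: bij_betw_cong del: restrict_apply add: restrict_apply')
  ultimately have "?f \<in> auto \<Gamma>" by (simp add: auto_def Bij_def)
  moreover have "?f elt_a = u" "?f elt_b = v"
    using word_eval_elt[OF group_Gamma cl] by simp_all
  ultimately show "\<exists>\<phi>\<in>auto \<Gamma>. \<phi> elt_a = u \<and> \<phi> elt_b = v" by blast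
next
  assume "\<exists>\<phi>\<in>auto \<Gamma>. \<phi> elt_a = u \<and> \<phi> elt_b = v"
  then obtain \<phi> where p: "\<phi> \<in> auto \<Gamma>" "\<phi> elt_a = u" "\<phi> elt_b = v" by blast
  have "bij_betw \<phi> (carrier \<Gamma>) (carrier \<Gamma>)" using p(1) by (simp add: auto_def Bij_def)
  then have "bij_betw (word_eval \<Gamma> u v) (carrier \<Gamma>) (carrier \<Gamma>)"
    using hom_eq_word_eval[OF group_Gamma autoD(1)[OF p(1)]] p(2,3) by (simp cong: bij_betw_cong)
  then show "free_basis u v"
    using auto_simps(3)[OF p(1)] p(2,3) by (auto simp: free_basis_def carrier_Gamma)
qed

lemma free_basis_closed:
  "free_basis u v \<Longrightarrow> u \<in> carrier \<Gamma>" "free_basis u v \<Longrightarrow> v \<in> carrier \<Gamma>"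
  by (simp_all add: free_basis_def)

lemma free_basis_auto:
  assumes "\<phi> \<in> auto \<Gamma>" "free_basis u v"
  shows "free_basis (\<phi> u) (\<phi> v)"
proof -
  interpret A: group "AutoGroup \<Gamma>" by (rule \<Gamma>.AutoGroup)
  obtain \<psi> where p: "\<psi> \<in> auto \<Gamma>" "\<psi> elt_a = u" "\<psi> elt_b = v"
    using assms(2) by (auto simp: free_basis_iff_auto)
  have "compose (carrier \<Gamma>) \<phi> \<psi> \<in> auto \<Gamma>"
    using A.m_closed[of \<phi> \<psi>] assms(1) p(1) by (simp add: AutoGroup_simps)
  then show ?thesis
    unfolding free_basis_iff_auto using p by (intro bexI[of _ "compose (carrier \<Gamma>) \<phi> \<psi>"]) (simp_all add: compose_eq)
qed

lemma auto_inverse: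
  assumes "\<phi> \<in> auto \<Gamma>"
  shows "\<exists>\<psi>\<in>auto \<Gamma>. (\<forall>x\<in>carrier \<Gamma>. \<phi> (\<psi> x) = x) \<and> (\<forall>x\<in>carrier \<Gamma>. \<psi> (\<phi> x) = x)"
proof -
  interpret A: group "AutoGroup \<Gamma>" by (rule \<Gamma>.AutoGroup)
  let ?\<psi> = "inv\<^bsub>AutoGroup \<Gamma>\<^esub> \<phi>"
  have q: "?\<psi> \<in> auto \<Gamma>"
    using A.inv_closed[of \<phi>] assms by (simp add: AutoGroup_simps)
  have "compose (carrier \<Gamma>) ?\<psi> \<phi> = (\<lambda>g\<in>carrier \<Gamma>. g)" "compose (carrier \<Gamma>) \<phi> ?\<psi> = (\<lambda>g\<in>carrier \<Gamma>. g)"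
    using A.l_inv[of \<phi>] A.r_inv[of \<phi>] assms q by (simp_all add: AutoGroup_simps)
  then have "\<forall>x\<in>carrier \<Gamma>. \<phi> (?\<psi> x) = x" "\<forall>x\<in>carrier \<Gamma>. ?\<psi> (\<phi> x) = x"
    by (metis compose_eq restrict_apply')+
  with q show ?thesis by (intro bexI[of _ ?\<psi>] conjI)
qed

text \<open>
  To recognise a basis it is enough to exhibit the pair that defines the inverse substitution.
\<close>

lemma free_basisI:
  assumes "u \<in> carrier \<Gamma>" "v \<in> carrier \<Gamma>" "u' \<in> carrier \<Gamma>" "v' \<in> carrier \<Gamma>"
    and "word_eval \<Gamma> u v u' = elt_a" "word_eval \<Gamma> u v v' = elt_b"
    and "word_eval \<Gamma> u' v' u = elt_a" "word_eval \<Gamma> u' v' v = elt_b"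
  shows "free_basis u v"
proof -
  let ?f = "word_eval \<Gamma> u v" and ?g = "word_eval \<Gamma> u' v'"
  have f: "?f \<in> hom \<Gamma> \<Gamma>" and g: "?g \<in> hom \<Gamma> \<Gamma>"
    using word_eval_hom[OF group_Gamma] assms(1-4) by auto
  have id: "(\<lambda>x. x) \<in> hom \<Gamma> \<Gamma>" by (simp add: hom_def)
  have gf: "(\<lambda>x. ?g (?f x)) \<in> hom \<Gamma> \<Gamma>" and fg: "(\<lambda>x. ?f (?g x)) \<in> hom \<Gamma> \<Gamma>"
    using f g by (auto simp: hom_def Pi_iff)
  note e = word_eval_elt[OF group_Gamma assms(1,2)] word_eval_elt[OF group_Gamma assms(3,4)]
  have "?g (?f x) = x" "?f (?g x) = x" if "x \<in> carrier \<Gamma>" for x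
    using hom_Gamma_eqI[OF group_Gamma gf id _ _ that] hom_Gamma_eqI[OF group_Gamma fg id _ _ that] e assms
    by simp_all
  then have "bij_betw ?f (carrier \<Gamma>) (carrier \<Gamma>)"
    using f g by (intro bij_betw_byWitness[where f' = ?g]) (auto simp: hom_def)
  then show ?thesis using assms(1,2) by (simp add: free_basis_def carrier_Gamma)
qed

lemma word_eval_simps:
  assumes "u \<in> carrier \<Gamma>" "v \<in> carrier \<Gamma>"
  shows "x \<in> carrier \<Gamma> \<Longrightarrow> y \<in> carrier \<Gamma> \<Longrightarrow> word_eval \<Gamma> u v (x \<otimes>\<^bsub>\<Gamma>\<^esub> y) = word_eval \<Gamma> u v x \<otimes>\<^bsub>\<Gamma>\<^esub> word_eval \<Gamma> u v y"
    "x \<in> carrier \<Gamma> \<Longrightarrow> word_eval \<Gamma> u v (inv\<^bsub>\<Gamma>\<^esub> x) = inv\<^bsub>\<Gamma>\<^esub> word_eval \<Gamma> u v x"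
    "word_eval \<Gamma> u v elt_a = u" "word_eval \<Gamma> u v elt_b = v"
  using hom_Gamma_simps[OF group_Gamma word_eval_hom[OF group_Gamma assms]] 
    word_eval_elt[OF group_Gamma assms] by auto

lemma
  assumes "free_basis u v"
  shows free_basis_swap: "free_basis v u"
    and free_basis_inv: "free_basis (inv\<^bsub>\<Gamma>\<^esub> u) v"
    and free_basis_mult: "free_basis u (u \<otimes>\<^bsub>\<Gamma>\<^esub> v)"
    and free_basis_conj: "k \<in> carrier \<Gamma> \<Longrightarrow> free_basis (conjugate k u) (conjugate k v)"
proof -
  let ?a = elt_a and ?b = elt_b
  obtain \<phi> where p: "\<phi> \<in> auto \<Gamma>" "\<phi> ?a = u" "\<phi> ?b = v"
    using assms by (auto simp: free_basis_iff_auto)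
  have "free_basis ?b ?a"
    by (rule free_basisI[where u' = ?b and v' = ?a]) (simp_all add: word_eval_simps)
  from free_basis_auto[OF p(1) this] show "free_basis v u" using p by simp
  have "free_basis (inv\<^bsub>\<Gamma>\<^esub> ?a) ?b"
    by (rule free_basisI[where u' = "inv\<^bsub>\<Gamma>\<^esub> ?a" and v' = ?b]) (simp_all add: word_eval_simps)
  from free_basis_auto[OF p(1) this] show "free_basis (inv\<^bsub>\<Gamma>\<^esub> u) v" using p by (simp add: auto_simps)
  have "free_basis ?a (?a \<otimes>\<^bsub>\<Gamma>\<^esub> ?b)"
    by (rule free_basisI[where u' = "?a" and v' = "inv\<^bsub>\<Gamma>\<^esub> ?a \<otimes>\<^bsub>\<Gamma>\<^esub> ?b"])
      (simp_all add: word_eval_simps free_simps)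
  from free_basis_auto[OF p(1) this] show "free_basis u (u \<otimes>\<^bsub>\<Gamma>\<^esub> v)" using p by (simp add: auto_simps)
  show "free_basis (conjugate k u) (conjugate k v)" if k: "k \<in> carrier \<Gamma>"
    using free_basis_auto[OF inner_auto[OF k] assms] free_basis_closed[OF assms] by (simp add: inner_def)
qed

section \<open>Nielsen's theorem in rank two\<close>

text \<open>
  The elementary moves contain all simultaneous conjugations.  These are products of the other moves,
  but having them at hand allows shortening a basis by conjugation in the proof of Nielsen's theorem.
\<close>

inductive nielsen :: "letter list \<Rightarrow> letter list \<Rightarrow> bool" where
  base: "nielsen elt_a elt_b"
| swap: "nielsen u v \<Longrightarrow> nielsen v u"
| inv: "nielsen u v \<Longrightarrow> nielsen (inv\<^bsub>\<Gamma>\<^esub> u) v"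
| mult: "nielsen u v \<Longrightarrow> nielsen u (u \<otimes>\<^bsub>\<Gamma>\<^esub> v)"
| conj: "nielsen u v \<Longrightarrow> k \<in> carrier \<Gamma> \<Longrightarrow> nielsen (conjugate k u) (conjugate k v)"

abbreviation word_inv :: "letter list \<Rightarrow> letter list" where
  "word_inv w \<equiv> rev (map flip_letter w)"

lemma flip_letter_neq [simp]: "flip_letter l \<noteq> l" "l \<noteq> flip_letter l"
  by (cases l; simp add: flip_letter_def)+

lemma flip_letter_inject [simp]: "flip_letter k = flip_letter l \<longleftrightarrow> k = l"
  by (metis flip_flip)

lemma word_inv_inv [simp]: "word_inv (word_inv w) = w"
  by (simp add: rev_map comp_def)

lemma reduced_iff_nth: "reduced w \<longleftrightarrow> (\<forall>i. Suc i < length w \<longrightarrow> w ! Suc i \<noteq> flip_letter (w ! i))"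
proof (induction w rule: reduced.induct)
  case (3 k l w)
  then show ?case by (auto simp: nth_Cons split: nat.splits)
qed auto

lemma reduced_append:
  "reduced (x @ y) \<longleftrightarrow> reduced x \<and> reduced y \<and> (x = [] \<or> y = [] \<or> hd y \<noteq> flip_letter (last x))"
proof (induction x rule: reduced.induct)
  case (2 l)
  then show ?case by (cases y) auto
qed auto

lemma reduced_word_inv: "reduced w \<Longrightarrow> reduced (word_inv w)"
proof (induction w rule: reduced.induct)
  case (3 k l w)
  then show ?case by (auto simp: reduced_append last_rev)
qed auto

lemma mult_append: "reduced (x @ y) \<Longrightarrow> x \<otimes>\<^bsub>\<Gamma>\<^esub> y = x @ y"
  using foldr_push_Nil[of "x @ y"] foldr_push_Nil[of y] by (simp add: mult_Gamma reduced_append)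

lemma inv_Gamma: "reduced w \<Longrightarrow> inv\<^bsub>\<Gamma>\<^esub> w = word_inv w"
  using foldr_push_inverse[of "[]" w]
  by (intro \<Gamma>.inv_equality) (simp_all add: carrier_Gamma mult_Gamma one_Gamma reduced_word_inv foldr_push_Nil)

lemma length_inv: "w \<in> carrier \<Gamma> \<Longrightarrow> length (inv\<^bsub>\<Gamma>\<^esub> w) = length w"
  by (simp add: inv_Gamma carrier_Gamma)

text \<open>
  When \<open>p\<close> is the whole of what cancels in the product, the remainders of both factors can be
  concatenated without further reduction.
\<close>

lemma mult_cancel_prefix:
  assumes "x \<in> carrier \<Gamma>" "y \<in> carrier \<Gamma>" "inv\<^bsub>\<Gamma>\<^esub> x = p @ t" "y = p @ y'"
    and "t = [] \<or> y' = [] \<or> hd t \<noteq> hd y'"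
  shows "x \<otimes>\<^bsub>\<Gamma>\<^esub> y = word_inv t @ y'" "x = word_inv t @ word_inv p"
proof -
  have x: "reduced x" and y: "reduced (p @ y')" using assms by (simp_all add: carrier_Gamma)
  have "word_inv x = p @ t" using assms(3) inv_Gamma[OF x] by simp
  then have "word_inv (word_inv x) = word_inv t @ word_inv p" by simp
  then show xe: "x = word_inv t @ word_inv p" by simp
  have r: "reduced (word_inv t @ y')"
    using x y assms(5) unfolding xe reduced_append by (cases t) (auto simp: last_rev)
  have "foldr push (word_inv p) (p @ y') = y'"
    using foldr_push_inverse[of y' p] mult_append[OF y] y by (simp add: mult_Gamma reduced_append)
  then show "x \<otimes>\<^bsub>\<Gamma>\<^esub> y = word_inv t @ y'"
    using mult_append[OF r] by (simp add: mult_Gamma xe assms(4))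
qed

lemma longest_common_prefix_split:
  obtains t t' where "x = longest_common_prefix x y @ t" "y = longest_common_prefix x y @ t'"
    "t = [] \<or> t' = [] \<or> hd t \<noteq> hd t'"
proof -
  have "\<exists>t t'. x = longest_common_prefix x y @ t \<and> y = longest_common_prefix x y @ t' \<and>
    (t = [] \<or> t' = [] \<or> hd t \<noteq> hd t')"
    by (induction x y rule: longest_common_prefix.induct) auto
  with that show thesis by blast
qed

definition cancellation :: "letter list \<Rightarrow> letter list \<Rightarrow> nat" where
  "cancellation x y = length (longest_common_prefix (inv\<^bsub>\<Gamma>\<^esub> x) y)"

lemma cancellation_split:
  obtains p t y' where "inv\<^bsub>\<Gamma>\<^esub> x = p @ t" "y = p @ y'" "length p = cancellation x y"
    "t = [] \<or> y' = [] \<or> hd t \<noteq> hd y'"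
  using longest_common_prefix_split[of "inv\<^bsub>\<Gamma>\<^esub> x" y] unfolding cancellation_def by metis

lemma length_mult:
  assumes "x \<in> carrier \<Gamma>" "y \<in> carrier \<Gamma>"
  shows "length (x \<otimes>\<^bsub>\<Gamma>\<^esub> y) + 2 * cancellation x y = length x + length y"
proof -
  obtain p t y' where s: "inv\<^bsub>\<Gamma>\<^esub> x = p @ t" "y = p @ y'" "length p = cancellation x y"
    "t = [] \<or> y' = [] \<or> hd t \<noteq> hd y'"
    by (rule cancellation_split)
  show ?thesis
    using mult_cancel_prefix[OF assms s(1,2,4)] s(2,3) by simp
qed

lemma length_mult_le:
  "x \<in> carrier \<Gamma> \<Longrightarrow> y \<in> carrier \<Gamma> \<Longrightarrow> length (x \<otimes>\<^bsub>\<Gamma>\<^esub> y) \<le> length x + length y"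
  using length_mult[of x y] by simp

text \<open>
  If half of \<open>u\<close> cancelled in \<open>u u\<close>, then \<open>u\<close> would read the same as its inverse up to the middle: the
  middle letter would be its own inverse, or the two middle letters would be inverse to each other.
\<close>

lemma cancellation_self:
  assumes u: "u \<in> carrier \<Gamma>" and "u \<noteq> []"
  shows "2 * cancellation u u < length u"
proof (rule ccontr)
  let ?n = "length u"
  assume le: "\<not> ?thesis"
  obtain p t y' where s: "inv\<^bsub>\<Gamma>\<^esub> u = p @ t" "u = p @ y'" "length p = cancellation u u"
    by (rule cancellation_split)
  have r: "reduced u" using u by (simp add: carrier_Gamma)
  have np: "?n \<le> 2 * length p" using le s(3) by simp
  have sym: "u ! i = flip_letter (u ! (?n - 1 - i))" if "i < length p" for i
  proof -
    have "length p \<le> ?n" using s(2) by (metis length_append le_add1)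
    then have "i < ?n" using that by simp
    have "u ! i = (inv\<^bsub>\<Gamma>\<^esub> u) ! i" using s(1,2) that by (metis nth_append)
    then show ?thesis using \<open>i < ?n\<close> by (simp add: inv_Gamma[OF r] rev_nth)
  qed
  show False
  proof (cases "even ?n")
    case True
    then obtain m where m: "?n = 2 * m" by (elim evenE)
    then obtain j where j: "m = Suc j" using \<open>u \<noteq> []\<close> by (cases m) auto
    have "u ! j = flip_letter (u ! Suc j)" using sym[of j] np m j by simp
    then have "u ! Suc j = flip_letter (u ! j)" by simp
    moreover have "Suc j < ?n" using m j by simp
    ultimately show False using r by (auto simp: reduced_iff_nth)
  next
    case False
    then obtain m where m: "?n = 2 * m + 1" by (elim oddE)
    then have "u ! m = flip_letter (u ! m)" using sym[of m] np by simp
    then show False by simp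
  qed
qed

lemma word_eval_Nil: "word_eval G u v [] = \<one>\<^bsub>G\<^esub>"
  and word_eval_Cons: "word_eval G u v (l # w) = letter_eval G u v l \<otimes>\<^bsub>G\<^esub> word_eval G u v w"
  by (simp_all add: word_eval_def)

text \<open>
  The conditions \<open>half\<close> and \<open>less\<close> are Nielsen's conditions: in a freely reduced product of the words
  \<open>u\<^sup>\<plusminus>\<^sup>1, v\<^sup>\<plusminus>\<^sup>1\<close> at most half of each factor cancels against each of its neighbours, and not all of it
  against both.  Then every factor keeps at least one letter, and the part of the first factor that
  survives is a prefix of the product.  The prefix is recorded for the sake of the induction, in which
  a new factor on the left meets only this prefix.
\<close>

lemma nielsen_reduced_word_eval:
  fixes u v
  defines "X \<equiv> letter_eval \<Gamma> u v"
  assumes uv: "u \<in> carrier \<Gamma>" "v \<in> carrier \<Gamma>"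
    and half: "\<And>k l. l \<noteq> flip_letter k \<Longrightarrow>
      2 * cancellation (X k) (X l) \<le> length (X k) \<and> 2 * cancellation (X k) (X l) \<le> length (X l)"
    and less: "\<And>k l m. l \<noteq> flip_letter k \<Longrightarrow> m \<noteq> flip_letter l \<Longrightarrow>
      cancellation (X k) (X l) + cancellation (X l) (X m) < length (X l)"
  shows "reduced (k # w) \<Longrightarrow> \<exists>A. length w \<le> length A \<and> word_eval \<Gamma> u v (k # w) =
    take (length (X k) - (if w = [] then 0 else cancellation (X k) (X (hd w)))) (X k) @ A"
proof (induction w arbitrary: k)
  case Nil
  have "X k \<in> carrier \<Gamma>" using letter_eval_closed[OF group_Gamma uv] by (simp add: X_def)
  then show ?case by (simp add: word_eval_Cons word_eval_Nil flip: X_def)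
next
  case (Cons l w)
  let ?c = "if w = [] then 0 else cancellation (X l) (X (hd w))"
  let ?s = "take (length (X l) - ?c) (X l)"
  have X: "X k \<in> carrier \<Gamma>" for k using letter_eval_closed[OF group_Gamma uv] by (simp add: X_def)
  have r: "l \<noteq> flip_letter k" "reduced (l # w)" using Cons.prems by auto
  obtain A where A: "length w \<le> length A" "word_eval \<Gamma> u v (l # w) = ?s @ A"
    using Cons.IH[OF r(2)] by blast
  obtain p t y where s: "inv\<^bsub>\<Gamma>\<^esub> (X k) = p @ t" "X l = p @ y" "length p = cancellation (X k) (X l)"
    "t = [] \<or> y = [] \<or> hd t \<noteq> hd y"
    by (rule cancellation_split)
  have "length p + ?c < length (X l)"
  proof (cases w)
    case Nil
    have "cancellation (X k) (X l) + cancellation (X l) (X l) < length (X l)"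
      using less[OF r(1), of l] by simp
    then show ?thesis using Nil s(3) by simp
  next
    case (Cons m w')
    then show ?thesis using less[OF r(1), of m] r(2) s(3) by auto
  qed
  then obtain s' where s': "?s = p @ s'" "s' \<noteq> []" "hd s' = hd y"
    using s(2) by (intro that[of "take (length y - ?c) y"]) (auto simp: hd_take)
  have E: "?s @ A \<in> carrier \<Gamma>"
    using word_eval_closed[OF group_Gamma uv, of "l # w"] A(2) by simp
  have "t = [] \<or> s' @ A = [] \<or> hd t \<noteq> hd (s' @ A)"
    using s(4) s' s(2) \<open>length p + ?c < length (X l)\<close> by auto
  then have "X k \<otimes>\<^bsub>\<Gamma>\<^esub> (?s @ A) = word_inv t @ s' @ A" "X k = word_inv t @ word_inv p"
    using mult_cancel_prefix[OF X E s(1), of "s' @ A"] s'(1) by simp_all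
  moreover have "word_eval \<Gamma> u v (k # l # w) = X k \<otimes>\<^bsub>\<Gamma>\<^esub> (?s @ A)"
    using A(2) by (simp only: word_eval_Cons[of _ _ _ k] X_def)
  moreover have "length (l # w) \<le> length (s' @ A)" using A(1) s'(2) by (cases s') auto
  ultimately show ?case using s(3) by (intro exI[of _ "s' @ A"]) simp
qed

definition bad :: "letter list \<Rightarrow> letter list \<Rightarrow> bool" where
  "bad u v \<longleftrightarrow> free_basis u v \<and> \<not> nielsen u v"

lemma bad_closed: "bad u v \<Longrightarrow> u \<in> carrier \<Gamma>" "bad u v \<Longrightarrow> v \<in> carrier \<Gamma>"
  by (auto simp: bad_def dest: free_basis_closed)

lemma bad_swap: "bad u v \<Longrightarrow> bad v u"
  unfolding bad_def using free_basis_swap nielsen.swap by blast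

lemma bad_inv: "bad u v \<Longrightarrow> bad (inv\<^bsub>\<Gamma>\<^esub> u) v"
  unfolding bad_def using free_basis_inv nielsen.inv[of "inv\<^bsub>\<Gamma>\<^esub> u" v] 
  by (auto dest: free_basis_closed)

text \<open>
  The set of bad bases is closed under the elementary moves because these can be undone by elementary
  moves.
\<close>

lemma bad_mult:
  assumes "bad u v"
  shows "bad u (u \<otimes>\<^bsub>\<Gamma>\<^esub> v)"
proof -
  have "nielsen u v" if "nielsen u (u \<otimes>\<^bsub>\<Gamma>\<^esub> v)"
    using nielsen.inv[OF nielsen.mult[OF nielsen.inv[OF that]]] bad_closed[OF assms] by (simp add: free_simps)
  then show ?thesis using assms free_basis_mult by (auto simp: bad_def)
qed

lemma bad_mult': 
  assumes "bad u v"
  shows "bad (u \<otimes>\<^bsub>\<Gamma>\<^esub> v) v"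
proof -
  have "bad (inv\<^bsub>\<Gamma>\<^esub> v) (inv\<^bsub>\<Gamma>\<^esub> u)" using assms by (blast intro: bad_inv bad_swap)
  then have "bad (inv\<^bsub>\<Gamma>\<^esub> v) (inv\<^bsub>\<Gamma>\<^esub> (u \<otimes>\<^bsub>\<Gamma>\<^esub> v))"
    using bad_mult bad_closed[OF assms] by (simp add: \<Gamma>.inv_mult_group)
  then have "bad (inv\<^bsub>\<Gamma>\<^esub> (inv\<^bsub>\<Gamma>\<^esub> (u \<otimes>\<^bsub>\<Gamma>\<^esub> v))) (inv\<^bsub>\<Gamma>\<^esub> (inv\<^bsub>\<Gamma>\<^esub> v))" by (blast intro: bad_inv bad_swap)
  then show ?thesis using bad_closed[OF assms] by simp
qed

lemma bad_conj:
  assumes "bad u v" "k \<in> carrier \<Gamma>"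
  shows "bad (conjugate k u) (conjugate k v)"
proof -
  note cl = bad_closed[OF assms(1)]
  have "nielsen u v" if "nielsen (conjugate k u) (conjugate k v)"
    using nielsen.conj[OF that, of "inv\<^bsub>\<Gamma>\<^esub> k"] assms(2) cl by (simp add: free_simps)
  then show ?thesis using assms free_basis_conj by (auto simp: bad_def)
qed

lemma bad_nonempty: "bad u v \<Longrightarrow> u \<noteq> []"
proof
  assume "bad u v" "u = []"
  then have "inj_on (word_eval \<Gamma> u v) {w. reduced w}" "word_eval \<Gamma> u v elt_a = []" "word_eval \<Gamma> u v [] = []"
    using bad_closed[of u v] word_eval_elt[OF group_Gamma, of u v]
    by (auto simp: bad_def free_basis_def bij_betw_def word_eval_Nil one_Gamma)
  then have "elt_a = []" by (auto simp: inj_on_def)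
  then show False by (simp add: elt_a_def)
qed

text \<open>
  A bad basis of least total length satisfies Nielsen's conditions, since a violation leads to a shorter
  bad basis.  A nonempty reduced product of \<open>n\<close> factors from it then has length at least \<open>n\<close>, so that
  \<open>a\<close> and \<open>b\<close>, which it generates, are among \<open>u\<^sup>\<plusminus>\<^sup>1, v\<^sup>\<plusminus>\<^sup>1\<close>; but then it is not bad.
\<close>

locale minimal_bad =
  fixes N :: nat
  assumes minimal: "bad u v \<Longrightarrow> N \<le> length u + length v"
begin

definition least :: "letter list \<Rightarrow> letter list \<Rightarrow> bool" where
  "least u v \<longleftrightarrow> bad u v \<and> length u + length v = N"

lemma least_swap: "least u v \<Longrightarrow> least v u"
  by (auto simp: least_def bad_swap)

lemma least_inv: "least u v \<Longrightarrow> least (inv\<^bsub>\<Gamma>\<^esub> u) v"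
  by (auto simp: least_def bad_inv length_inv dest: bad_closed)

text \<open>
  Cancelling more than half of \<open>u\<close> or of \<open>v\<close> would make \<open>u v\<close> a shorter replacement for the other word.
\<close>

lemma least_half:
  assumes "least u v"
  shows "2 * cancellation u v \<le> length u" "2 * cancellation u v \<le> length v"
proof -
  have b: "bad u v" and N: "length u + length v = N" using assms by (auto simp: least_def)
  show "2 * cancellation u v \<le> length u" "2 * cancellation u v \<le> length v"
    using minimal[OF bad_mult[OF b]] minimal[OF bad_mult'[OF b]] length_mult[OF bad_closed[OF b]] N
    by linarith+
qed

text \<open>
  If \<open>u\<close>, \<open>u\<inverse>\<close> and \<open>v\<close> all begin with \<open>s\<close>, then conjugation by \<open>s\<inverse>\<close> shortens \<open>u\<close> by two letters and does
  not lengthen \<open>v\<close>.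
\<close>

lemma least_no_common_letter:
  assumes "least u v" "u = s # x" "inv\<^bsub>\<Gamma>\<^esub> u = s # y" "v = s # z"
  shows False
proof -
  have b: "bad u v" and N: "length u + length v = N" using assms by (auto simp: least_def)
  note cl = bad_closed[OF b]
  have r: "reduced u" "reduced v" using cl by (simp_all add: carrier_Gamma)
  have s: "[s] \<in> carrier \<Gamma>" by (simp add: carrier_Gamma)
  have "word_inv u = s # y" using assms(3) inv_Gamma[OF r(1)] by simp
  then have "word_inv (word_inv u) = word_inv y @ [flip_letter s]" by simp
  then have "s # x = word_inv y @ [flip_letter s]" using assms(2) by simp
  then obtain m where m: "u = [s] @ m @ [flip_letter s]"
    using assms(2) by (cases "word_inv y") auto
  then have "u = [s] \<otimes>\<^bsub>\<Gamma>\<^esub> (m \<otimes>\<^bsub>\<Gamma>\<^esub> inv\<^bsub>\<Gamma>\<^esub> [s])" "m \<in> carrier \<Gamma>"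
    using r(1) mult_append[of "[s]" "m @ [flip_letter s]"] mult_append[of m "[flip_letter s]"]
    by (simp_all add: reduced_append inv_letter_Gamma carrier_Gamma del: append_Cons)
  then have u': "conjugate (inv\<^bsub>\<Gamma>\<^esub> [s]) u = m"
    using s by (simp add: free_simps)
  have z: "v = [s] \<otimes>\<^bsub>\<Gamma>\<^esub> z" "z \<in> carrier \<Gamma>"
    using r(2) assms(4) mult_append[of "[s]" z] by (simp_all add: carrier_Gamma reduced_tl)
  then have "conjugate (inv\<^bsub>\<Gamma>\<^esub> [s]) v = z \<otimes>\<^bsub>\<Gamma>\<^esub> [s]"
    using s by (simp add: free_simps)
  then have "length (conjugate (inv\<^bsub>\<Gamma>\<^esub> [s]) v) \<le> length v"
    using length_mult_le[OF z(2) s] assms(4) by simp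
  moreover have "length m + 2 = length u" using m by simp
  ultimately show False
    using minimal[OF bad_conj[OF b, of "inv\<^bsub>\<Gamma>\<^esub> [s]"]] s N u' by simp
qed

text \<open>
  Suppose that \<open>v = p q\<close> cancels completely in \<open>t v t\<close>, half against each side.  Then \<open>t = q\<inverse> m p\<inverse>\<close>,
  so that conjugation by \<open>q\<close> turns \<open>t v\<close> into \<open>m\<close> and \<open>v\<close> into \<open>q p\<close>.  This is a bad basis of total length
  at most that of \<open>t\<close>.
\<close>

lemma least_no_half_half:
  assumes "least t v" "2 * cancellation t v = length v" "2 * cancellation v t = length v"
  shows False
proof -
  have b: "bad t v" and N: "length t + length v = N" using assms by (auto simp: least_def)
  note cl = bad_closed[OF b]
  have r: "reduced t" "reduced v" using cl by (simp_all add: carrier_Gamma)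
  obtain p t1 q where p: "inv\<^bsub>\<Gamma>\<^esub> t = p @ t1" "v = p @ q" "length p = cancellation t v"
    by (rule cancellation_split)
  obtain q' v1 t2 where q: "inv\<^bsub>\<Gamma>\<^esub> v = q' @ v1" "t = q' @ t2" "length q' = cancellation v t"
    by (rule cancellation_split)
  have lq: "length q' = length q" "length p = length q" using p q assms by auto
  have "q' @ v1 = word_inv q @ word_inv p" using q(1) p(2) inv_Gamma[OF r(2)] by simp
  then have q': "q' = word_inv q" using lq by simp
  have "word_inv t = p @ t1" using p(1) inv_Gamma[OF r(1)] by simp
  then have "word_inv (word_inv t) = word_inv t1 @ word_inv p" by simp
  then have t: "t = word_inv t1 @ word_inv p" by simp
  have "length v \<le> length t" using least_half(1)[OF assms(1)] assms(2) by simp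
  then have "length (word_inv q) \<le> length (word_inv t1)"
    using p(2) t by (metis length_append length_rev length_map add_le_cancel_right add.commute lq(2))
  moreover have "word_inv q @ t2 = word_inv t1 @ word_inv p" using t q(2) q' by simp
  ultimately obtain m where m: "word_inv t1 = word_inv q @ m"
    by (metis append_eq_append_conv_if append_take_drop_id)
  then have t': "t = word_inv q @ m @ word_inv p" using t by simp
  have cl': "p \<in> carrier \<Gamma>" "q \<in> carrier \<Gamma>" "m \<in> carrier \<Gamma>"
    using r p(2) t' by (auto simp: carrier_Gamma reduced_append)
  then have "reduced p" "reduced q" by (simp_all add: carrier_Gamma)
  have "t = inv\<^bsub>\<Gamma>\<^esub> q \<otimes>\<^bsub>\<Gamma>\<^esub> (m \<otimes>\<^bsub>\<Gamma>\<^esub> inv\<^bsub>\<Gamma>\<^esub> p)" "v = p \<otimes>\<^bsub>\<Gamma>\<^esub> q"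
    using r t' p(2) mult_append[of "word_inv q" "m @ word_inv p"] mult_append[of m "word_inv p"] mult_append[of p q]
      inv_Gamma[OF \<open>reduced p\<close>] inv_Gamma[OF \<open>reduced q\<close>]
    by (simp_all add: reduced_append)
  then have "conjugate q (t \<otimes>\<^bsub>\<Gamma>\<^esub> v) = m" "conjugate q v = q \<otimes>\<^bsub>\<Gamma>\<^esub> p"
    using cl' by (simp_all add: free_simps)
  then have "N \<le> length m + length (q \<otimes>\<^bsub>\<Gamma>\<^esub> p)"
    using minimal[OF bad_conj[OF bad_mult'[OF b] cl'(2)]] by simp
  also have "\<dots> \<le> length m + length v" using length_mult_le[OF cl'(2,1)] p(2) by simp
  also have "\<dots> = length t" using t' p(2) by simp
  finally have "length v = 0" using N by linarith
  then show False using bad_nonempty[OF bad_swap[OF b]] by simp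
qed

lemma no_least: "\<not> least u v"
proof
  assume uv: "least u v"
  then have b: "bad u v" by (simp add: least_def)
  note cl = bad_closed[OF b]
  let ?X = "letter_eval \<Gamma> u v"
  have X: "?X k \<in> carrier \<Gamma>" for k using letter_eval_closed[OF group_Gamma cl] .
  have least: "least (?X k) (?X l)" if "fst k \<noteq> fst l" for k l
  proof -
    have *: "least x y \<and> least y x" if "x \<in> {u, inv\<^bsub>\<Gamma>\<^esub> u}" "y \<in> {v, inv\<^bsub>\<Gamma>\<^esub> v}" for x y
      using that uv least_inv least_swap by blast
    obtain s e s' e' where kl: "k = (s, e)" "l = (s', e')" by (cases k, cases l) auto
    show ?thesis
      using that by (cases s; cases s') (auto simp: kl Let_def *)
  qed
  have nonempty: "?X k \<noteq> []" for k
  proof -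
    have "least (?X k) (?X (if fst k = gen_a then gen_b else gen_a, True))" by (rule least) auto
    then show ?thesis using bad_nonempty by (auto simp: least_def)
  qed
  have same: "k = l" if "l \<noteq> flip_letter k" "fst k = fst l" for k l :: letter
    using that by (cases k; cases l) (auto simp: flip_letter_def)
  have half: "2 * cancellation (?X k) (?X l) \<le> length (?X k) \<and> 2 * cancellation (?X k) (?X l) \<le> length (?X l)"
    if "l \<noteq> flip_letter k" for k l
    using least_half[OF least, of k l] cancellation_self[OF X nonempty, of k] same[OF that]
    by (cases "fst k = fst l") auto
  have less: "cancellation (?X k) (?X l) + cancellation (?X l) (?X m) < length (?X l)"
    if kl: "l \<noteq> flip_letter k" and lm: "m \<noteq> flip_letter l" for k l m
  proof (rule ccontr)
    assume "\<not> ?thesis"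
    with half[OF kl] half[OF lm] have eq: "2 * cancellation (?X k) (?X l) = length (?X l)"
      "2 * cancellation (?X l) (?X m) = length (?X l)" by auto
    have neq: "fst k \<noteq> fst l" "fst l \<noteq> fst m"
      using eq cancellation_self[OF X nonempty, of l] same[OF kl] same[OF lm] by auto
    (* A middle factor that cancels completely has on both sides either the same word, or
       two mutually inverse ones.  In the second case three of the four words share their
       first letter. *)
    show False
    proof (cases "m = k")
      case True
      then show False using least_no_half_half[OF least[OF neq(1)]] eq by simp
    next
      case False
      have "fst m = fst k" using neq by (metis (full_types) gen.exhaust)
      then have "m = flip_letter k" using same[of m k] False by (metis flip_flip)
      then have Xm: "?X m = inv\<^bsub>\<Gamma>\<^esub> ?X k" by (simp add: letter_eval_flip[OF group_Gamma cl])
      have l: "length (?X l) > 0" using nonempty by simp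
      obtain p t y where p: "inv\<^bsub>\<Gamma>\<^esub> ?X k = p @ t" "?X l = p @ y" "length p = cancellation (?X k) (?X l)"
        by (rule cancellation_split)
      obtain q t' y' where q: "inv\<^bsub>\<Gamma>\<^esub> ?X l = q @ t'" "?X m = q @ y'" "length q = cancellation (?X l) (?X m)"
        by (rule cancellation_split)
      have "p \<noteq> []" "q \<noteq> []" using p(3) q(3) eq l by auto
      then obtain s p' where "p = s # p'" by (cases p) auto
      moreover obtain s' q' where "q = s' # q'" using \<open>q \<noteq> []\<close> by (cases q) auto
      ultimately have "?X l = s # p' @ y" "?X m = s # p' @ t" "inv\<^bsub>\<Gamma>\<^esub> ?X l = s # q' @ t'"
        using p q Xm by auto
      then show False using least_no_common_letter[OF least[OF neq(2)]] by blast
    qed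
  qed
  have single: "\<exists>k. ?X k = x" if x: "x \<in> carrier \<Gamma>" "length x = 1" for x
  proof -
    have "x \<in> word_eval \<Gamma> u v ` {w. reduced w}"
      using b x by (auto simp: bad_def free_basis_def bij_betw_def)
    then obtain w where w: "reduced w" "word_eval \<Gamma> u v w = x" by auto
    then obtain k w' where kw: "w = k # w'" using x by (cases w) (auto simp: word_eval_Nil one_Gamma)
    define c where "c = (if w' = [] then 0 else cancellation (?X k) (?X (hd w')))"
    obtain A where A: "length w' \<le> length A" "x = take (length (?X k) - c) (?X k) @ A"
      using nielsen_reduced_word_eval[OF cl half less, of k w'] w kw unfolding c_def by auto
    have "2 * c \<le> length (?X k)"
      using half[of "hd w'" k] w(1) kw by (cases w') (auto simp: c_def)
    moreover have "length (?X k) > 0" using nonempty by simp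
    ultimately have "c < length (?X k)" by linarith
    then have "length (take (length (?X k) - c) (?X k)) > 0" by simp
    moreover have "length x = length (take (length (?X k) - c) (?X k)) + length A"
      using A(2) by (metis length_append)
    ultimately have "length w' = 0" using A(1) x(2) by linarith
    then have "w' = []" by simp
    then have "x = ?X k" using w(2) kw X[of k] by (simp add: word_eval_Cons word_eval_Nil del: letter_eval.simps)
    then show ?thesis by blast
  qed
  obtain k where k: "?X k = elt_a" using single[of elt_a] by (auto simp: elt_a_def carrier_Gamma)
  obtain l where l: "?X l = elt_b" using single[of elt_b] by (auto simp: elt_b_def carrier_Gamma)
  have "fst k \<noteq> fst l"
  proof
    assume "fst k = fst l"
    then have "l = k \<or> l = flip_letter k" using same[of l k] by auto
    then have "elt_b = elt_a \<or> elt_b = inv\<^bsub>\<Gamma>\<^esub> elt_a"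
      using k l by (auto simp: letter_eval_flip[OF group_Gamma cl])
    then show False by (auto simp: elt_a_def elt_b_def inv_letter_Gamma flip_letter_def)
  qed
  then have "bad elt_a elt_b" using least[of k l] k l by (simp add: least_def)
  then show False using nielsen.base by (simp add: bad_def)
qed

end

text \<open>
  Nielsen's theorem: the automorphisms of the free group of rank two are generated by the elementary
  ones.
\<close>

theorem free_basis_nielsen:
  assumes "free_basis u v"
  shows "nielsen u v"
proof (rule ccontr)
  assume "\<not> ?thesis"
  then have "bad u v" using assms by (simp add: bad_def)
  then obtain u0 v0 where m: "bad u0 v0" "\<And>u v. bad u v \<Longrightarrow> length u0 + length v0 \<le> length u + length v"
    using ex_has_least_nat[of "\<lambda>(u, v). bad u v" "(u, v)" "\<lambda>(u, v). length u + length v"] by auto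
  interpret minimal_bad "length u0 + length v0" by standard (rule m(2))
  show False using no_least[of u0 v0] m(1) by (simp add: least_def)
qed

section \<open>The orientation of a basis\<close>

definition commutator :: "letter list \<Rightarrow> letter list \<Rightarrow> letter list" where
  "commutator u v = u \<otimes>\<^bsub>\<Gamma>\<^esub> v \<otimes>\<^bsub>\<Gamma>\<^esub> inv\<^bsub>\<Gamma>\<^esub> u \<otimes>\<^bsub>\<Gamma>\<^esub> inv\<^bsub>\<Gamma>\<^esub> v"

lemma commutator_closed [simp]: "u \<in> carrier \<Gamma> \<Longrightarrow> v \<in> carrier \<Gamma> \<Longrightarrow> commutator u v \<in> carrier \<Gamma>"
  by (simp add: commutator_def)

lemma inv_conjugate:
  "k \<in> carrier \<Gamma> \<Longrightarrow> g \<in> carrier \<Gamma> \<Longrightarrow> inv\<^bsub>\<Gamma>\<^esub> conjugate k g = conjugate k (inv\<^bsub>\<Gamma>\<^esub> g)"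
  by (simp add: free_simps)

lemma nielsen_closed: "nielsen u v \<Longrightarrow> u \<in> carrier \<Gamma> \<and> v \<in> carrier \<Gamma>"
  by (induction rule: nielsen.induct) auto

text \<open>
  These identities make the conjugacy class of the commutator, up to inversion, an invariant of Nielsen
  equivalence.
\<close>

lemma commutator_moves:
  assumes "u \<in> carrier \<Gamma>" "v \<in> carrier \<Gamma>"
  shows "commutator v u = inv\<^bsub>\<Gamma>\<^esub> commutator u v"
    and "commutator (inv\<^bsub>\<Gamma>\<^esub> u) v = conjugate (inv\<^bsub>\<Gamma>\<^esub> u) (inv\<^bsub>\<Gamma>\<^esub> commutator u v)"
    and "commutator u (inv\<^bsub>\<Gamma>\<^esub> v) = conjugate (inv\<^bsub>\<Gamma>\<^esub> v) (inv\<^bsub>\<Gamma>\<^esub> commutator u v)"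
    and "commutator u (u \<otimes>\<^bsub>\<Gamma>\<^esub> v) = conjugate u (commutator u v)"
    and "k \<in> carrier \<Gamma> \<Longrightarrow> commutator (conjugate k u) (conjugate k v) = conjugate k (commutator u v)"
  using assms by (simp_all add: commutator_def free_simps)

lemma nielsen_commutator:
  assumes "nielsen u v"
  shows "\<exists>k\<in>carrier \<Gamma>. commutator u v \<in> {conjugate k comm_ab, conjugate k (inv\<^bsub>\<Gamma>\<^esub> comm_ab)}"
  using assms
proof (induction rule: nielsen.induct)
  case base
  have "commutator elt_a elt_b = conjugate \<one>\<^bsub>\<Gamma>\<^esub> comm_ab"
    using conjugate_one[OF comm_ab_closed] by (simp add: comm_ab_def commutator_def)
  then show ?case by blast
next
  case (swap u v)
  then show ?case
    using nielsen_closed[OF swap.hyps] comm_ab_closed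
    by (auto simp: commutator_moves(1)[of u v] inv_conjugate)
next
  case (inv u v)
  then obtain k where k: "k \<in> carrier \<Gamma>" "commutator u v \<in> {conjugate k comm_ab, conjugate k (inv\<^bsub>\<Gamma>\<^esub> comm_ab)}"
    by blast
  then show ?case
    using nielsen_closed[OF inv.hyps] comm_ab_closed
    by (intro bexI[of _ "inv\<^bsub>\<Gamma>\<^esub> u \<otimes>\<^bsub>\<Gamma>\<^esub> k"]) (auto simp: commutator_moves(2-5) inv_conjugate conjugate_conjugate)
next
  case (mult u v)
  then obtain k where k: "k \<in> carrier \<Gamma>" "commutator u v \<in> {conjugate k comm_ab, conjugate k (inv\<^bsub>\<Gamma>\<^esub> comm_ab)}"
    by blast
  then show ?case
    using nielsen_closed[OF mult.hyps] comm_ab_closed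
    by (intro bexI[of _ "u \<otimes>\<^bsub>\<Gamma>\<^esub> k"]) (auto simp: commutator_moves(2-5) inv_conjugate conjugate_conjugate)
next
  case (conj u v j)
  then obtain k where k: "k \<in> carrier \<Gamma>" "commutator u v \<in> {conjugate k comm_ab, conjugate k (inv\<^bsub>\<Gamma>\<^esub> comm_ab)}"
    by blast
  then show ?case
    using nielsen_closed[OF conj.hyps(1)] conj.hyps(2) comm_ab_closed
    by (intro bexI[of _ "j \<otimes>\<^bsub>\<Gamma>\<^esub> k"]) (auto simp: commutator_moves(2-5) inv_conjugate conjugate_conjugate)
qed

lemma Aut_plus_commutator:
  assumes "\<phi> \<in> auto \<Gamma>"
  shows "\<phi> \<in> Aut_plus \<longleftrightarrow> (\<exists>k\<in>carrier \<Gamma>. commutator (\<phi> elt_a) (\<phi> elt_b) = conjugate k comm_ab)"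
  using assms by (simp add: Aut_plus_def comm_ab_def commutator_def auto_simps)

text \<open>
  The commutator of a basis is conjugate to that of \<open>(a, b)\<close> or to its inverse, and inverting \<open>v\<close>
  switches between the two cases.
\<close>

lemma free_basis_oriented:
  assumes "free_basis u v"
  obtains \<phi> where "\<phi> \<in> Aut_plus" "\<phi> elt_a = u" "\<phi> elt_b \<in> {v, inv\<^bsub>\<Gamma>\<^esub> v}"
proof -
  note cl = free_basis_closed[OF assms]
  obtain k where k: "k \<in> carrier \<Gamma>" "commutator u v \<in> {conjugate k comm_ab, conjugate k (inv\<^bsub>\<Gamma>\<^esub> comm_ab)}"
    using nielsen_commutator[OF free_basis_nielsen[OF assms]] by blast
  obtain w where w: "w \<in> {v, inv\<^bsub>\<Gamma>\<^esub> v}" "free_basis u w"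
    "\<exists>k\<in>carrier \<Gamma>. commutator u w = conjugate k comm_ab"
  proof (cases "commutator u v = conjugate k comm_ab")
    case True
    then show thesis using that[of v] k assms by blast
  next
    case False
    then have "commutator u (inv\<^bsub>\<Gamma>\<^esub> v) = conjugate (inv\<^bsub>\<Gamma>\<^esub> v \<otimes>\<^bsub>\<Gamma>\<^esub> k) comm_ab"
      using k cl comm_ab_closed by (auto simp: commutator_moves(2-5) inv_conjugate conjugate_conjugate)
    then show thesis
      using that[of "inv\<^bsub>\<Gamma>\<^esub> v"] k(1) cl free_basis_swap[OF free_basis_inv[OF free_basis_swap[OF assms]]] by blast
  qed
  then obtain \<phi> where p: "\<phi> \<in> auto \<Gamma>" "\<phi> elt_a = u" "\<phi> elt_b = w"
    by (auto simp: free_basis_iff_auto)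
  then have "\<phi> \<in> Aut_plus" using w(3) by (simp add: Aut_plus_commutator)
  then show thesis using that p w(1) by blast
qed

section \<open>The Farey tessellation around a curve\<close>

text \<open>
  The vertices of the Farey tessellation are curves, and its edges are pairs of curves that form a
  basis.  The neighbours of the curve \<open>a\<close> are the \<open>a\<^sup>n b\<close>, and consecutive ones are joined by an edge.
  Every edge \<open>{p, q}\<close> belongs to two triangles, with the third vertices \<open>p q\<close> and \<open>p q\<inverse>\<close>.
\<close>

inductive neighbour :: "letter list \<Rightarrow> bool" where
  "neighbour elt_b"
| "neighbour q \<Longrightarrow> neighbour (elt_a \<otimes>\<^bsub>\<Gamma>\<^esub> q)"
| "neighbour q \<Longrightarrow> neighbour (inv\<^bsub>\<Gamma>\<^esub> elt_a \<otimes>\<^bsub>\<Gamma>\<^esub> q)"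

text \<open>
  The edges that do not contain \<open>a\<close>, written as pairs \<open>(p, q)\<close> for which the triangle on the side away
  from \<open>a\<close> has \<open>p q\<close> as its third vertex.  The other two edges of that triangle are outer again.
\<close>

inductive outer :: "letter list \<Rightarrow> letter list \<Rightarrow> bool" where
  outer_base: "neighbour q \<Longrightarrow> outer q (elt_a \<otimes>\<^bsub>\<Gamma>\<^esub> q)"
| outer_left: "outer p q \<Longrightarrow> outer p (p \<otimes>\<^bsub>\<Gamma>\<^esub> q)"
| outer_right: "outer p q \<Longrightarrow> outer (p \<otimes>\<^bsub>\<Gamma>\<^esub> q) q"

text \<open>
  The pairs of words that represent an edge: simultaneous conjugation and the inversion or exchange of
  the words do not change the curves.
\<close>

inductive edge :: "letter list \<Rightarrow> letter list \<Rightarrow> bool" where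
  edge_inner: "neighbour q \<Longrightarrow> edge elt_a q"
| edge_outer: "outer p q \<Longrightarrow> edge p q"
| edge_swap: "edge u v \<Longrightarrow> edge v u"
| edge_inv: "edge u v \<Longrightarrow> edge (inv\<^bsub>\<Gamma>\<^esub> u) v"
| edge_conj: "edge u v \<Longrightarrow> k \<in> carrier \<Gamma> \<Longrightarrow> edge (conjugate k u) (conjugate k v)"

lemma neighbour_closed: "neighbour q \<Longrightarrow> q \<in> carrier \<Gamma>"
  by (induction rule: neighbour.induct) auto

lemma outer_closed: "outer p q \<Longrightarrow> p \<in> carrier \<Gamma> \<and> q \<in> carrier \<Gamma>"
  by (induction rule: outer.induct) (auto simp: neighbour_closed)

lemma edge_closed: "edge u v \<Longrightarrow> u \<in> carrier \<Gamma> \<and> v \<in> carrier \<Gamma>"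
  by (induction rule: edge.induct) (auto simp: neighbour_closed outer_closed)

lemma edge_invI:
  assumes "edge u (inv\<^bsub>\<Gamma>\<^esub> v)" "v \<in> carrier \<Gamma>"
  shows "edge u v"
  using edge_inv[OF edge_swap[OF assms(1)]] assms(2) by (auto intro: edge_swap)

lemma edge_conjI:
  assumes "edge u v" "k \<in> carrier \<Gamma>" "conjugate k u = u'" "conjugate k v = v'"
  shows "edge u' v'"
  using edge_conj[OF assms(1,2)] assms(3,4) by simp

text \<open>
  The other edges of both triangles at an edge are again edges; so the edges found by walking
  outwards from \<open>a\<close> are already closed under the move from \<open>(u, v)\<close> to \<open>(u, u v)\<close>.  All
  four adjacent edges are treated together because inverting \<open>v\<close> interchanges the two triangles.
\<close>

lemma edge_adjacent:
  assumes "edge u v"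
  shows "edge u (u \<otimes>\<^bsub>\<Gamma>\<^esub> v) \<and> edge v (u \<otimes>\<^bsub>\<Gamma>\<^esub> v) \<and> edge u (u \<otimes>\<^bsub>\<Gamma>\<^esub> inv\<^bsub>\<Gamma>\<^esub> v) \<and> edge v (u \<otimes>\<^bsub>\<Gamma>\<^esub> inv\<^bsub>\<Gamma>\<^esub> v)"
  using assms
proof (induction rule: edge.induct)
  case (edge_inner q)
  let ?a = elt_a
  note cl = neighbour_closed[OF edge_inner]
  (* The triangle with vertices a, q and a^-1 q, on the side opposite to that of a q. *)
  have "edge ?a (inv\<^bsub>\<Gamma>\<^esub> ?a \<otimes>\<^bsub>\<Gamma>\<^esub> q)" by (intro edge.edge_inner neighbour.intros(3) edge_inner)
  from edge_conj[OF this ab_closed(1)] have a1: "edge ?a (q \<otimes>\<^bsub>\<Gamma>\<^esub> inv\<^bsub>\<Gamma>\<^esub> ?a)" using cl by (simp add: free_simps)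
  have 1: "edge ?a (?a \<otimes>\<^bsub>\<Gamma>\<^esub> inv\<^bsub>\<Gamma>\<^esub> q)" by (rule edge_invI[of ?a]) (use cl a1 in \<open>simp_all add: free_simps\<close>)
  have "edge (inv\<^bsub>\<Gamma>\<^esub> ?a \<otimes>\<^bsub>\<Gamma>\<^esub> q) (?a \<otimes>\<^bsub>\<Gamma>\<^esub> (inv\<^bsub>\<Gamma>\<^esub> ?a \<otimes>\<^bsub>\<Gamma>\<^esub> q))"
    by (intro edge_outer outer_base neighbour.intros(3) edge_inner)
  then have "edge (inv\<^bsub>\<Gamma>\<^esub> ?a \<otimes>\<^bsub>\<Gamma>\<^esub> q) q" using cl by (simp add: free_simps)
  from edge_conj[OF edge_swap[OF this] cl] have a2: "edge q (q \<otimes>\<^bsub>\<Gamma>\<^esub> inv\<^bsub>\<Gamma>\<^esub> ?a)" using cl by (simp add: free_simps)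
  have 2: "edge q (?a \<otimes>\<^bsub>\<Gamma>\<^esub> inv\<^bsub>\<Gamma>\<^esub> q)" by (rule edge_invI[of q]) (use cl a2 in \<open>simp_all add: free_simps\<close>)
  have "edge ?a (?a \<otimes>\<^bsub>\<Gamma>\<^esub> q)" "edge q (?a \<otimes>\<^bsub>\<Gamma>\<^esub> q)"
    using edge_inner by (auto intro: edge.edge_inner edge_outer outer_base neighbour.intros(2))
  with 1 2 show ?case by blast
next
  case (edge_outer p q)
  note cl = outer_closed[OF edge_outer]
  have "edge p (p \<otimes>\<^bsub>\<Gamma>\<^esub> q)" "edge q (p \<otimes>\<^bsub>\<Gamma>\<^esub> q)"
    using outer_left[OF edge_outer] edge_swap[OF edge.edge_outer[OF outer_right[OF edge_outer]]]
    by (simp_all add: edge.edge_outer)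
  (* The triangle on the side of a is the one from which the walk arrived at the edge. *)
  moreover have "edge p (p \<otimes>\<^bsub>\<Gamma>\<^esub> inv\<^bsub>\<Gamma>\<^esub> q)" "edge q (p \<otimes>\<^bsub>\<Gamma>\<^esub> inv\<^bsub>\<Gamma>\<^esub> q)"
    using edge_outer
  proof (induction rule: outer.induct)
    case (outer_base q)
    note cl = neighbour_closed[OF outer_base]
    have "neighbour (elt_a \<otimes>\<^bsub>\<Gamma>\<^esub> q)" using outer_base by (rule neighbour.intros)
    then have "edge elt_a q" "edge elt_a (elt_a \<otimes>\<^bsub>\<Gamma>\<^esub> q)" using outer_base by (auto intro: edge_inner)
    then have *: "edge q (inv\<^bsub>\<Gamma>\<^esub> elt_a)" "edge (elt_a \<otimes>\<^bsub>\<Gamma>\<^esub> q) (inv\<^bsub>\<Gamma>\<^esub> elt_a)"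
      by (simp_all add: edge_swap[OF edge_inv])
    { case 1 show ?case using * cl by (simp add: free_simps) }
    { case 2 show ?case using * cl by (simp add: free_simps) }
  next
    case (outer_left p q)
    note cl = outer_closed[OF outer_left.hyps]
    have e: "edge p (inv\<^bsub>\<Gamma>\<^esub> q)" "edge (inv\<^bsub>\<Gamma>\<^esub> q) (p \<otimes>\<^bsub>\<Gamma>\<^esub> q)"
      using edge.edge_outer[OF outer_left.hyps] edge.edge_outer[OF outer.outer_right[OF outer_left.hyps]]
      by (simp_all add: edge_swap edge_swap[OF edge_inv[OF edge_swap]] edge_inv[OF edge_swap])
    { case 1 show ?case by (rule edge_conjI[OF e(1), of p]) (use cl in \<open>simp_all add: free_simps\<close>) }
    { case 2 show ?case by (rule edge_conjI[OF edge_swap[OF edge_conj[OF e(2), of q]], of p]) 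
          (use cl in \<open>simp_all add: free_simps\<close>) }
  next
    case (outer_right p q)
    note cl = outer_closed[OF outer_right.hyps]
    have e: "edge q p" "edge (p \<otimes>\<^bsub>\<Gamma>\<^esub> q) p"
      using edge.edge_outer[OF outer_right.hyps] edge.edge_outer[OF outer.outer_left[OF outer_right.hyps]]
      by (simp_all add: edge_swap)
    { case 1 show ?case using e cl by (simp add: free_simps) }
    { case 2 show ?case using e cl by (simp add: free_simps) }
  qed
  ultimately show ?case by blast
next
  case (edge_swap u v)
  note cl = edge_closed[OF edge_swap.hyps]
  have 1: "edge v (v \<otimes>\<^bsub>\<Gamma>\<^esub> u)"
    by (rule edge_conjI[of v "u \<otimes>\<^bsub>\<Gamma>\<^esub> v" v]) (use edge_swap.IH cl in \<open>simp_all add: free_simps\<close>)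
  have 2: "edge u (v \<otimes>\<^bsub>\<Gamma>\<^esub> u)"
    by (rule edge_conjI[of u "u \<otimes>\<^bsub>\<Gamma>\<^esub> v" "inv\<^bsub>\<Gamma>\<^esub> u"]) (use edge_swap.IH cl in \<open>simp_all add: free_simps\<close>)
  have 3: "edge v (v \<otimes>\<^bsub>\<Gamma>\<^esub> inv\<^bsub>\<Gamma>\<^esub> u)" "edge u (v \<otimes>\<^bsub>\<Gamma>\<^esub> inv\<^bsub>\<Gamma>\<^esub> u)"
    by (rule edge_invI; use edge_swap.IH cl in \<open>simp add: free_simps\<close>)+
  show ?case using 1 2 3 by blast
next
  case (edge_inv u v)
  note cl = edge_closed[OF edge_inv.hyps]
  have 1: "edge (inv\<^bsub>\<Gamma>\<^esub> u) (u \<otimes>\<^bsub>\<Gamma>\<^esub> v)" "edge (inv\<^bsub>\<Gamma>\<^esub> u) (u \<otimes>\<^bsub>\<Gamma>\<^esub> inv\<^bsub>\<Gamma>\<^esub> v)"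
    using edge_inv.IH by (simp_all add: edge.edge_inv)
  have 2: "edge (inv\<^bsub>\<Gamma>\<^esub> u) (inv\<^bsub>\<Gamma>\<^esub> u \<otimes>\<^bsub>\<Gamma>\<^esub> v)"
    by (rule edge_invI, rule edge_conjI[OF 1(2), of "inv\<^bsub>\<Gamma>\<^esub> u"]) (use cl in \<open>simp_all add: free_simps\<close>)
  have 3: "edge (inv\<^bsub>\<Gamma>\<^esub> u) (inv\<^bsub>\<Gamma>\<^esub> u \<otimes>\<^bsub>\<Gamma>\<^esub> inv\<^bsub>\<Gamma>\<^esub> v)"
    by (rule edge_invI, rule edge_conjI[OF 1(1), of "inv\<^bsub>\<Gamma>\<^esub> u"]) (use cl in \<open>simp_all add: free_simps\<close>)
  have 4: "edge v (inv\<^bsub>\<Gamma>\<^esub> u \<otimes>\<^bsub>\<Gamma>\<^esub> v)"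
    by (rule edge_invI, rule edge_conjI[of v "u \<otimes>\<^bsub>\<Gamma>\<^esub> inv\<^bsub>\<Gamma>\<^esub> v" "inv\<^bsub>\<Gamma>\<^esub> v"])
       (use edge_inv.IH cl in \<open>simp_all add: free_simps\<close>)
  have 5: "edge v (inv\<^bsub>\<Gamma>\<^esub> u \<otimes>\<^bsub>\<Gamma>\<^esub> inv\<^bsub>\<Gamma>\<^esub> v)"
    by (rule edge_invI, rule edge_conjI[of v "u \<otimes>\<^bsub>\<Gamma>\<^esub> v" v])
       (use edge_inv.IH cl in \<open>simp_all add: free_simps\<close>)
  show ?case using 2 3 4 5 by blast
next
  case (edge_conj u v k)
  note cl = edge_closed[OF edge_conj.hyps(1)]
  have "conjugate k u \<otimes>\<^bsub>\<Gamma>\<^esub> conjugate k v = conjugate k (u \<otimes>\<^bsub>\<Gamma>\<^esub> v)"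
    "conjugate k u \<otimes>\<^bsub>\<Gamma>\<^esub> inv\<^bsub>\<Gamma>\<^esub> conjugate k v = conjugate k (u \<otimes>\<^bsub>\<Gamma>\<^esub> inv\<^bsub>\<Gamma>\<^esub> v)"
    using cl edge_conj.hyps(2) by (simp_all add: free_simps)
  then show ?case using edge_conj.IH edge_conj.hyps(2) by (simp add: edge.edge_conj)
qed

lemma free_basis_edge:
  assumes "free_basis u v"
  shows "edge u v"
  using free_basis_nielsen[OF assms]
proof (induction rule: nielsen.induct)
  case base
  show ?case by (intro edge_inner neighbour.intros)
next
  case (swap u v)
  then show ?case by (simp add: edge_swap)
next
  case (inv u v)
  then show ?case by (simp add: edge_inv)
next
  case (mult u v)
  then show ?case by (simp add: edge_adjacent)
next
  case (conj u v k)
  then show ?case by (simp add: edge_conj)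
qed

lemma neighbour_free_basis: "neighbour q \<Longrightarrow> free_basis elt_a q"
proof (induction rule: neighbour.induct)
  case (3 q)
  then have "free_basis (inv\<^bsub>\<Gamma>\<^esub> (inv\<^bsub>\<Gamma>\<^esub> elt_a)) (inv\<^bsub>\<Gamma>\<^esub> elt_a \<otimes>\<^bsub>\<Gamma>\<^esub> q)"
    by (intro free_basis_inv free_basis_mult)
  then show ?case by simp
qed (auto intro: free_basis_ab free_basis_mult)

section \<open>Conjugacy classes of curves\<close>

lemma equiv_curve_rel: "equiv (carrier \<Gamma>) curve_rel"
proof (rule equivI)
  show "curve_rel \<subseteq> carrier \<Gamma> \<times> carrier \<Gamma>" by (auto simp: curve_rel_def)
  show "refl_on (carrier \<Gamma>) curve_rel"
  proof (rule refl_onI)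
    fix g assume "g \<in> carrier \<Gamma>"
    then show "(g, g) \<in> curve_rel"
      unfolding curve_rel_def using conjugate_one[of g] by (auto intro!: bexI[of _ "\<one>\<^bsub>\<Gamma>\<^esub>"])
  qed
  show "sym curve_rel"
  proof (rule symI)
    fix g h assume "(g, h) \<in> curve_rel"
    then obtain k where k: "g \<in> carrier \<Gamma>" "h \<in> carrier \<Gamma>" "k \<in> carrier \<Gamma>"
      "h = conjugate k g \<or> h = conjugate k (inv\<^bsub>\<Gamma>\<^esub> g)" by (auto simp: curve_rel_def)
    then have "g = conjugate (inv\<^bsub>\<Gamma>\<^esub> k) h \<or> g = conjugate (inv\<^bsub>\<Gamma>\<^esub> k) (inv\<^bsub>\<Gamma>\<^esub> h)"
      by (auto simp: inv_conjugate conjugate_conjugate conjugate_one)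
    then show "(h, g) \<in> curve_rel" using k by (auto simp: curve_rel_def)
  qed
  show "trans curve_rel"
  proof (rule transI)
    fix f g h assume "(f, g) \<in> curve_rel" "(g, h) \<in> curve_rel"
    then obtain j k where k: "f \<in> carrier \<Gamma>" "g \<in> carrier \<Gamma>" "h \<in> carrier \<Gamma>" "j \<in> carrier \<Gamma>" "k \<in> carrier \<Gamma>"
      "g = conjugate j f \<or> g = conjugate j (inv\<^bsub>\<Gamma>\<^esub> f)" "h = conjugate k g \<or> h = conjugate k (inv\<^bsub>\<Gamma>\<^esub> g)"
      by (auto simp: curve_rel_def)
    then have "h = conjugate (k \<otimes>\<^bsub>\<Gamma>\<^esub> j) f \<or> h = conjugate (k \<otimes>\<^bsub>\<Gamma>\<^esub> j) (inv\<^bsub>\<Gamma>\<^esub> f)"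
      by (auto simp: inv_conjugate conjugate_conjugate)
    then show "(f, h) \<in> curve_rel" using k by (auto simp: curve_rel_def)
  qed
qed

lemma curve_class_self: "g \<in> carrier \<Gamma> \<Longrightarrow> g \<in> curve_class g"
  by (rule equiv_class_self[OF equiv_curve_rel])

lemma curve_class_eq: "h \<in> curve_class g \<Longrightarrow> curve_class h = curve_class g"
  using equiv_class_eq[OF equiv_curve_rel, of g h] by simp

lemma conjugate_in_curve_class:
  "g \<in> carrier \<Gamma> \<Longrightarrow> k \<in> carrier \<Gamma> \<Longrightarrow> conjugate k g \<in> curve_class g"
  by (auto simp: curve_rel_def)

lemma inv_in_curve_class: "g \<in> carrier \<Gamma> \<Longrightarrow> inv\<^bsub>\<Gamma>\<^esub> g \<in> curve_class g"
  using conjugate_one[of "inv\<^bsub>\<Gamma>\<^esub> g"] by (auto simp: curve_rel_def intro!: bexI[of _ "\<one>\<^bsub>\<Gamma>\<^esub>"])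

lemma auto_curve_class:
  assumes "\<phi> \<in> auto \<Gamma>" "h \<in> curve_class g"
  shows "\<phi> h \<in> curve_class (\<phi> g)"
proof -
  obtain k where k: "g \<in> carrier \<Gamma>" "h \<in> carrier \<Gamma>" "k \<in> carrier \<Gamma>"
    "h = conjugate k g \<or> h = conjugate k (inv\<^bsub>\<Gamma>\<^esub> g)" using assms(2) by (auto simp: curve_rel_def)
  then have "\<phi> h = conjugate (\<phi> k) (\<phi> g) \<or> \<phi> h = conjugate (\<phi> k) (inv\<^bsub>\<Gamma>\<^esub> \<phi> g)"
    by (auto simp: auto_conjugate[OF assms(1)] auto_simps[OF assms(1)])
  then show ?thesis using k by (auto simp: curve_rel_def auto_simps(3)[OF assms(1)])
qed

section \<open>Traces of curves\<close>

lemma trace_inv_SL2C: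
  assumes "A \<in> carrier SL2C"
  shows "trace (inv\<^bsub>SL2C\<^esub> A) = trace A"
  using assms by (simp add: inv_SL2C trace_def sum_2)

lemma trace_mult_inv_SL2C:
  assumes "A \<in> carrier SL2C" "B \<in> carrier SL2C"
  shows "trace (A \<otimes>\<^bsub>SL2C\<^esub> B) + trace (A \<otimes>\<^bsub>SL2C\<^esub> inv\<^bsub>SL2C\<^esub> B) = trace A * trace B"
  using assms
  by (simp add: inv_SL2C trace_def sum_2 SL2C_simps matrix_matrix_mult_def algebra_simps)

text \<open>
  Fixing the homomorphism gives a trace function on words; the pullback of \<open>\<rho>\<close> by an automorphism is a
  second instance.
\<close>

locale sl2_rep =
  fixes \<rho> :: "letter list \<Rightarrow> complex^2^2"
  assumes rep: "\<rho> \<in> hom \<Gamma> SL2C"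
begin

definition T :: "letter list \<Rightarrow> complex" where
  "T g = trace (\<rho> g)"

lemmas rep_simps = hom_Gamma_simps[OF group_SL2C rep]

lemma T_inv: "g \<in> carrier \<Gamma> \<Longrightarrow> T (inv\<^bsub>\<Gamma>\<^esub> g) = T g"
  by (simp add: T_def rep_simps trace_inv_SL2C)

lemma T_conjugate: "k \<in> carrier \<Gamma> \<Longrightarrow> g \<in> carrier \<Gamma> \<Longrightarrow> T (conjugate k g) = T g"
  by (simp add: T_def conjugate_def rep_simps trace_conj)

lemma T_curve_class: "h \<in> curve_class g \<Longrightarrow> T h = T g"
  by (auto simp: curve_rel_def T_conjugate T_inv)

lemma T_mult_inv:
  "p \<in> carrier \<Gamma> \<Longrightarrow> q \<in> carrier \<Gamma> \<Longrightarrow> T (p \<otimes>\<^bsub>\<Gamma>\<^esub> q) = T p * T q - T (p \<otimes>\<^bsub>\<Gamma>\<^esub> inv\<^bsub>\<Gamma>\<^esub> q)"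
  using trace_mult_inv_SL2C[of "\<rho> p" "\<rho> q"] by (simp add: T_def rep_simps eq_diff_eq)

lemma T_mult_mult:
  assumes "p \<in> carrier \<Gamma>" "q \<in> carrier \<Gamma>"
  shows "T (p \<otimes>\<^bsub>\<Gamma>\<^esub> (p \<otimes>\<^bsub>\<Gamma>\<^esub> q)) = T p * T (p \<otimes>\<^bsub>\<Gamma>\<^esub> q) - T q"
proof -
  have "p \<otimes>\<^bsub>\<Gamma>\<^esub> inv\<^bsub>\<Gamma>\<^esub> (p \<otimes>\<^bsub>\<Gamma>\<^esub> q) = conjugate p (inv\<^bsub>\<Gamma>\<^esub> q)" using assms by (simp add: free_simps)
  then show ?thesis using T_mult_inv[of p "p \<otimes>\<^bsub>\<Gamma>\<^esub> q"] assms by (simp add: T_conjugate T_inv)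
qed

text \<open>
  Since \<open>tr p tr q = tr (p q) + tr (p q\<inverse>)\<close>, the last hypothesis gives
  \<open>\<bar>tr p\<bar> \<bar>tr q\<bar> \<le> 2 \<bar>tr (p q)\<bar>\<close>, where both factors on the left are greater than \<open>2\<close>.
\<close>

lemma fork:
  assumes "p \<in> carrier \<Gamma>" "q \<in> carrier \<Gamma>" "2 < cmod (T p)" "2 < cmod (T q)"
    and "cmod (T (p \<otimes>\<^bsub>\<Gamma>\<^esub> inv\<^bsub>\<Gamma>\<^esub> q)) \<le> cmod (T (p \<otimes>\<^bsub>\<Gamma>\<^esub> q))"
  shows "cmod (T q) < cmod (T (p \<otimes>\<^bsub>\<Gamma>\<^esub> q))" "cmod (T p) < cmod (T (p \<otimes>\<^bsub>\<Gamma>\<^esub> q))"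
proof -
  have "cmod (T p) * cmod (T q) = cmod (T (p \<otimes>\<^bsub>\<Gamma>\<^esub> q) + T (p \<otimes>\<^bsub>\<Gamma>\<^esub> inv\<^bsub>\<Gamma>\<^esub> q))"
    using T_mult_inv[OF assms(1,2)] by (simp add: norm_mult)
  also have "\<dots> \<le> 2 * cmod (T (p \<otimes>\<^bsub>\<Gamma>\<^esub> q))" using norm_triangle_ineq[of "T (p \<otimes>\<^bsub>\<Gamma>\<^esub> q)"] assms(5) by (smt (verit))
  finally have *: "cmod (T p) * cmod (T q) \<le> 2 * cmod (T (p \<otimes>\<^bsub>\<Gamma>\<^esub> q))" .
  have "2 * cmod (T q) < cmod (T p) * cmod (T q)" "cmod (T p) * 2 < cmod (T p) * cmod (T q)"
    using assms(3,4) by (intro mult_strict_right_mono mult_strict_left_mono; linarith)+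
  with * show "cmod (T q) < cmod (T (p \<otimes>\<^bsub>\<Gamma>\<^esub> q))" "cmod (T p) < cmod (T (p \<otimes>\<^bsub>\<Gamma>\<^esub> q))" by linarith+
qed

lemma norm_mult_diff_ge:
  fixes x y z :: complex
  assumes "2 < cmod x" "cmod y < cmod z"
  shows "cmod y \<le> cmod (x * z - y)"
proof -
  have "2 * cmod z \<le> cmod x * cmod z" using assms(1) by (intro mult_right_mono) auto
  then have "2 * cmod z \<le> cmod (x * z)" by (simp add: norm_mult)
  then show ?thesis using norm_triangle_ineq2[of "x * z" y] assms(2) by linarith
qed

text \<open>
  The induction carries along that the modulus of the trace does not decrease when the edge is crossed outwards.  For
  an edge next to \<open>a\<close> this holds because the product of the traces at the edge has modulus at least \<open>4\<close>
  while \<open>\<bar>tr a\<bar> \<le> 2\<close>.  Beyond it, crossing an edge of the next triangle replaces \<open>q\<close> by a curve of trace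
  \<open>tr p tr (p q) - tr q\<close>, and \<open>fork\<close> makes the first term large.
\<close>

lemma outer_large:
  assumes "cmod (T elt_a) \<le> 2" and nb: "\<And>q. neighbour q \<Longrightarrow> 2 < cmod (T q)"
    and "outer p q"
  shows "2 < cmod (T p) \<and> 2 < cmod (T q) \<and> cmod (T (p \<otimes>\<^bsub>\<Gamma>\<^esub> inv\<^bsub>\<Gamma>\<^esub> q)) \<le> cmod (T (p \<otimes>\<^bsub>\<Gamma>\<^esub> q))"
  using assms(3)
proof (induction rule: outer.induct)
  case (outer_base q)
  note cl = neighbour_closed[OF outer_base]
  have n: "2 < cmod (T q)" "2 < cmod (T (elt_a \<otimes>\<^bsub>\<Gamma>\<^esub> q))"
    using nb outer_base neighbour.intros(2) by blast+
  have "q \<otimes>\<^bsub>\<Gamma>\<^esub> inv\<^bsub>\<Gamma>\<^esub> (elt_a \<otimes>\<^bsub>\<Gamma>\<^esub> q) = inv\<^bsub>\<Gamma>\<^esub> elt_a" using cl by (simp add: free_simps)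
  then have a: "T (q \<otimes>\<^bsub>\<Gamma>\<^esub> inv\<^bsub>\<Gamma>\<^esub> (elt_a \<otimes>\<^bsub>\<Gamma>\<^esub> q)) = T elt_a" by (simp add: T_inv)
  have "2 * 2 \<le> cmod (T q) * cmod (T (elt_a \<otimes>\<^bsub>\<Gamma>\<^esub> q))" using n by (intro mult_mono) auto
  then have "2 * 2 \<le> cmod (T q * T (elt_a \<otimes>\<^bsub>\<Gamma>\<^esub> q))" by (simp add: norm_mult)
  then have "2 \<le> cmod (T (q \<otimes>\<^bsub>\<Gamma>\<^esub> (elt_a \<otimes>\<^bsub>\<Gamma>\<^esub> q)))"
    using T_mult_inv[of q "elt_a \<otimes>\<^bsub>\<Gamma>\<^esub> q"] cl a assms(1) norm_triangle_ineq2[of "T q * T (elt_a \<otimes>\<^bsub>\<Gamma>\<^esub> q)" "T elt_a"]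
    by simp
  then show ?case using n a assms(1) by simp
next
  case (outer_left p q)
  note cl = outer_closed[OF outer_left.hyps]
  have "p \<otimes>\<^bsub>\<Gamma>\<^esub> inv\<^bsub>\<Gamma>\<^esub> (p \<otimes>\<^bsub>\<Gamma>\<^esub> q) = conjugate p (inv\<^bsub>\<Gamma>\<^esub> q)" using cl by (simp add: free_simps)
  then have a: "T (p \<otimes>\<^bsub>\<Gamma>\<^esub> inv\<^bsub>\<Gamma>\<^esub> (p \<otimes>\<^bsub>\<Gamma>\<^esub> q)) = T q" using cl by (simp add: T_conjugate T_inv)
  have "cmod (T q) < cmod (T (p \<otimes>\<^bsub>\<Gamma>\<^esub> q))" using fork(1)[of p q] cl outer_left.IH by blast
  then show ?case using outer_left.IH cl a T_mult_inv[of p "p \<otimes>\<^bsub>\<Gamma>\<^esub> q"] norm_mult_diff_ge by simp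
next
  case (outer_right p q)
  note cl = outer_closed[OF outer_right.hyps]
  have a: "T (p \<otimes>\<^bsub>\<Gamma>\<^esub> q \<otimes>\<^bsub>\<Gamma>\<^esub> inv\<^bsub>\<Gamma>\<^esub> q) = T p" using cl by (simp add: free_simps)
  have "cmod (T p) < cmod (T (p \<otimes>\<^bsub>\<Gamma>\<^esub> q))" using fork(2)[of p q] cl outer_right.IH by blast
  then show ?case using outer_right.IH cl a T_mult_inv[of "p \<otimes>\<^bsub>\<Gamma>\<^esub> q" q] 
      norm_mult_diff_ge[of "T q" "T p" "T (p \<otimes>\<^bsub>\<Gamma>\<^esub> q)"] by (simp add: mult.commute)
qed

lemma edge_large:
  assumes "cmod (T elt_a) \<le> 2" and nb: "\<And>q. neighbour q \<Longrightarrow> 2 < cmod (T q)"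
    and "edge u v"
  shows "(u \<in> curve_class elt_a \<or> 2 < cmod (T u)) \<and> (v \<in> curve_class elt_a \<or> 2 < cmod (T v))"
  using assms(3)
proof (induction rule: edge.induct)
  case (edge_inner q)
  then show ?case using nb curve_class_self[OF ab_closed(1)] by blast
next
  case (edge_outer p q)
  then show ?case using outer_large[OF assms(1,2)] by blast
next
  case (edge_swap u v)
  then show ?case by blast
next
  case (edge_inv u v)
  have "inv\<^bsub>\<Gamma>\<^esub> u \<in> curve_class u" using edge_closed[OF edge_inv.hyps] inv_in_curve_class by blast
  then show ?case using edge_inv.IH curve_class_eq T_curve_class by metis
next
  case (edge_conj u v k)
  have "conjugate k u \<in> curve_class u" "conjugate k v \<in> curve_class v"
    using edge_closed[OF edge_conj.hyps(1)] edge_conj.hyps(2) conjugate_in_curve_class by blast+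
  then show ?case using edge_conj.IH curve_class_eq T_curve_class by metis
qed

text \<open>
  A second small curve \<open>g\<close> contradicts \<open>edge_large\<close> if all the neighbours of \<open>u\<close> are large.  The
  automorphism that sends \<open>(a, b)\<close> to \<open>(u, v)\<close> transports the Farey tessellation seen from \<open>a\<close> to the one
  seen from \<open>u\<close>.
\<close>

lemma small_neighbour:
  assumes "free_basis u v" "cmod (T u) \<le> 2"
    and "free_basis g h" "cmod (T g) \<le> 2" "g \<notin> curve_class u"
  shows "\<exists>w. free_basis u w \<and> cmod (T w) \<le> 2"
proof (rule ccontr)
  assume "\<not> ?thesis"
  then have large: "2 < cmod (T w)" if "free_basis u w" for w using that by fastforce
  obtain \<phi> where p: "\<phi> \<in> auto \<Gamma>" "\<phi> elt_a = u" "\<phi> elt_b = v"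
    using assms(1) by (auto simp: free_basis_iff_auto)
  obtain \<psi> where q: "\<psi> \<in> auto \<Gamma>" "\<forall>x\<in>carrier \<Gamma>. \<phi> (\<psi> x) = x"
    using auto_inverse[OF p(1)] by (elim bexE conjE) (rule that)
  note g = free_basis_closed(1)[OF assms(3)]
  interpret S: sl2_rep "\<lambda>x. \<rho> (\<phi> x)"
  proof
    show "(\<lambda>x. \<rho> (\<phi> x)) \<in> hom \<Gamma> SL2C"
      using autoD(1)[OF p(1)] rep by (auto simp: hom_def Pi_iff)
  qed
  have S: "S.T x = T (\<phi> x)" for x by (simp add: S.T_def T_def)
  have "2 < cmod (S.T q)" if "neighbour q" for q
    using free_basis_auto[OF p(1) neighbour_free_basis[OF that]] large p(2) by (simp add: S)
  moreover have "cmod (S.T elt_a) \<le> 2" using assms(2) p(2) by (simp add: S)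
  moreover have "\<not> 2 < cmod (S.T (\<psi> g))" using assms(4) bspec[OF q(2) g] by (simp add: S)
  ultimately have "\<psi> g \<in> curve_class elt_a"
    using S.edge_large[OF _ _ free_basis_edge[OF free_basis_auto[OF q(1) assms(3)]]] by metis
  then have "g \<in> curve_class u" using auto_curve_class[OF p(1)] bspec[OF q(2) g] p(2) by metis
  then show False using assms(5) by blast
qed

end

section \<open>Bounds on traces\<close>

lemma elliptic_recurrence_bounded:
  fixes y :: "nat \<Rightarrow> complex" and x :: real
  assumes x: "\<bar>x\<bar> < 2" and rec: "\<And>n. y (Suc (Suc n)) = of_real x * y (Suc n) - y n"
  obtains B where "\<And>n. cmod (y n) \<le> B"
proof -
  (* The matrix of the recursion preserves this quadratic form, which is definite for real x
     in (-2,2); since x is real, real and imaginary parts can be treated separately. *)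
  define Q where "Q r s = r\<^sup>2 + s\<^sup>2 - x * r * s" for r s :: real
  have Q_ge: "(1 - \<bar>x\<bar> / 2) * r\<^sup>2 \<le> Q r s" for r s
  proof -
    have "\<bar>x * (r * s)\<bar> \<le> \<bar>x\<bar> * ((r\<^sup>2 + s\<^sup>2) / 2)"
      unfolding abs_mult using sum_squares_bound[of "\<bar>r\<bar>" "\<bar>s\<bar>"] by (intro mult_left_mono) auto
    moreover have "0 \<le> (1 - \<bar>x\<bar> / 2) * s\<^sup>2" using x by simp
    ultimately show ?thesis by (simp add: Q_def algebra_simps)
  qed
  define E where "E n = Q (Re (y n)) (Re (y (Suc n))) + Q (Im (y n)) (Im (y (Suc n)))" for n
  have "E (Suc n) = E n" for n
    by (simp add: E_def Q_def rec power2_eq_square algebra_simps)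
  then have E: "E n = E 0" for n by (induction n) simp_all
  have le: "(1 - \<bar>x\<bar> / 2) * (cmod (y n))\<^sup>2 \<le> E 0" for n
    using Q_ge[of "Re (y n)" "Re (y (Suc n))"] Q_ge[of "Im (y n)" "Im (y (Suc n))"] E[of n]
    by (simp add: cmod_power2 E_def distrib_left)
  have "cmod (y n) \<le> sqrt (E 0 / (1 - \<bar>x\<bar> / 2))" for n
    using le[of n] x by (intro real_le_rsqrt) (simp add: field_simps)
  then show thesis by (rule that)
qed

text \<open>
  The equation of the surface is quadratic in \<open>z\<close> with leading coefficient \<open>1\<close> and bounded coefficients.
\<close>

lemma cubic_surface_bounded:
  assumes "(x, y, z) \<in> cubic_surface \<tau>" "cmod x \<le> 2" "cmod y \<le> 2"
  shows "cmod z \<le> cmod \<tau> + 10"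
proof (rule ccontr)
  assume "\<not> ?thesis"
  then have z: "cmod z > cmod \<tau> + 10" by simp
  have "z\<^sup>2 = x * y * z + (\<tau> + 2 - x\<^sup>2 - y\<^sup>2)" using assms(1) by (simp add: cubic_surface_def algebra_simps)
  then have "(cmod z)\<^sup>2 \<le> cmod (x * y * z) + cmod (\<tau> + 2 - x\<^sup>2 - y\<^sup>2)"
    by (metis norm_power norm_triangle_ineq)
  moreover have "cmod (\<tau> + 2 - x\<^sup>2 - y\<^sup>2) \<le> cmod (\<tau> + 2) + cmod (x\<^sup>2) + cmod (y\<^sup>2)"
    using norm_triangle_ineq4[of "\<tau> + 2 - x\<^sup>2" "y\<^sup>2"] norm_triangle_ineq4[of "\<tau> + 2" "x\<^sup>2"] by linarith
  moreover have "cmod (\<tau> + 2) \<le> cmod \<tau> + 2" using norm_triangle_ineq[of \<tau> 2] by simp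
  moreover have "cmod (x\<^sup>2) \<le> 4" "cmod (y\<^sup>2) \<le> 4"
    using power_mono[OF assms(2), of 2] power_mono[OF assms(3), of 2] by (simp_all add: norm_power)
  moreover have "cmod (x * y * z) \<le> 4 * cmod z"
    using mult_right_mono[OF mult_mono[OF assms(2,3)], of "cmod z"] by (simp add: norm_mult)
  moreover have "10 * cmod z \<le> (cmod z)\<^sup>2" using z norm_ge_zero[of \<tau>] unfolding power2_eq_square by (intro mult_right_mono) linarith+
  ultimately show False using z norm_ge_zero[of \<tau>] by linarith
qed

section \<open>The action of mapping classes on traces\<close>

definition mapping_class :: "(letter list \<Rightarrow> letter list) \<Rightarrow> (letter list \<Rightarrow> letter list) set" where
  "mapping_class \<phi> = Inner #>\<^bsub>(AutoGroup \<Gamma>)\<lparr>carrier := Aut_plus\<rparr>\<^esub> \<phi>"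

lemma Aut_plus_auto: "\<phi> \<in> Aut_plus \<Longrightarrow> \<phi> \<in> auto \<Gamma>"
  by (simp add: Aut_plus_def)

lemma mapping_class_eq:
  "\<phi> \<in> Aut_plus \<Longrightarrow> mapping_class \<phi> = {compose (carrier \<Gamma>) (inner k) \<phi> | k. k \<in> carrier \<Gamma>}"
  using Aut_plus_auto inner_auto unfolding mapping_class_def Inner_def r_coset_def
  by (auto simp: AutoGroup_simps)

lemma mapping_class_MCG: "\<phi> \<in> Aut_plus \<Longrightarrow> mapping_class \<phi> \<in> carrier MCG"
  by (auto simp: mapping_class_def MCG_def FactGroup_def RCOSETS_def)

lemma mapping_class_self:
  assumes "\<phi> \<in> Aut_plus"
  shows "\<phi> \<in> mapping_class \<phi>"
proof -
  have "compose (carrier \<Gamma>) (inner \<one>\<^bsub>\<Gamma>\<^esub>) \<phi> = \<phi>"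
    using autoD(3,4)[OF Aut_plus_auto[OF assms]]
    by (auto simp: compose_def inner_def conjugate_one fun_eq_iff extensional_def)
  then show ?thesis using mapping_class_eq[OF assms] by force
qed

text \<open>
  Used to tell mapping classes apart: equal classes send \<open>a\<close> to the same curve, and \<open>(a, b)\<close> to
  simultaneously conjugate bases.
\<close>

lemma mapping_class_eqD:
  assumes "\<phi> \<in> Aut_plus" "\<psi> \<in> Aut_plus" "mapping_class \<phi> = mapping_class \<psi>"
  obtains k where "k \<in> carrier \<Gamma>" "\<And>g. g \<in> carrier \<Gamma> \<Longrightarrow> \<psi> g = conjugate k (\<phi> g)"
proof -
  obtain k where k: "k \<in> carrier \<Gamma>" "\<psi> = compose (carrier \<Gamma>) (inner k) \<phi>"
    using mapping_class_self[OF assms(2)] mapping_class_eq[OF assms(1)] assms(3) by auto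
  show thesis
    by (rule that[OF k(1)]) (use autoD(4)[OF Aut_plus_auto[OF assms(1)]] k(2) in \<open>simp add: compose_eq inner_def\<close>)
qed

lemma trace_coords_mcg_act:
  assumes "\<rho> \<in> tau_reps \<tau>" "\<phi> \<in> Aut_plus"
  shows "mcg_act (mapping_class \<phi>) (conj_rel \<tau> `` {\<rho>}) \<in> \<X> \<tau>"
    and "trace_coords (mcg_act (mapping_class \<phi>) (conj_rel \<tau> `` {\<rho>})) =
      (trace (\<rho> (\<phi> elt_a)), trace (\<rho> (\<phi> elt_b)), trace (\<rho> (\<phi> elt_a \<otimes>\<^bsub>\<Gamma>\<^esub> \<phi> elt_b)))"
proof -
  let ?\<sigma> = "compose (carrier \<Gamma>) \<rho> \<phi>"
  note c = mcg_act_class[OF assms(1) mapping_class_MCG[OF assms(2)] mapping_class_self[OF assms(2)]]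
  show X: "mcg_act (mapping_class \<phi>) (conj_rel \<tau> `` {\<rho>}) \<in> \<X> \<tau>"
    using c unfolding \<X>_def by (simp add: quotientI)
  have s: "?\<sigma> \<in> mcg_act (mapping_class \<phi>) (conj_rel \<tau> `` {\<rho>})"
    using c equiv_class_self[OF equiv_conj_rel] by simp
  show "trace_coords (mcg_act (mapping_class \<phi>) (conj_rel \<tau> `` {\<rho>})) =
      (trace (\<rho> (\<phi> elt_a)), trace (\<rho> (\<phi> elt_b)), trace (\<rho> (\<phi> elt_a \<otimes>\<^bsub>\<Gamma>\<^esub> \<phi> elt_b)))"
    using auto_simps(1)[OF Aut_plus_auto[OF assms(2)]]
    by (simp add: trace_coords_def tr_eq[OF X s] compose_eq)
qed

section \<open>Limits in the character variety\<close>

lemma trace_coords_surj: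
  assumes "(x, y, z) \<in> cubic_surface \<tau>"
  obtains c where "c \<in> \<X> \<tau>" "trace_coords c = (x, y, z)"
proof -
  (* With the matrices A and B below the trace of A B is - s - 1/s, which equals z for a root s of
     s^2 + z s + 1. *)
  define s where "s = (- z + csqrt (z\<^sup>2 - 4)) / 2"
  have "2 * s = - z + csqrt (z\<^sup>2 - 4)" by (simp add: s_def)
  then have "2 * s + z = csqrt (z\<^sup>2 - 4)" by (simp only: add.commute) simp
  then have "(2 * s + z)\<^sup>2 = z\<^sup>2 - 4" by simp
  then have "4 * (s\<^sup>2 + z * s + 1) = 0" by (simp add: power2_eq_square algebra_simps)
  then have s: "s\<^sup>2 + z * s + 1 = 0" by (metis mult_eq_0_iff zero_neq_numeral)
  then have s0: "s \<noteq> 0" by auto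
  define A :: "complex^2^2" where "A = vector [vector [x, 1], vector [-1, 0]]"
  define B :: "complex^2^2" where "B = vector [vector [0, s], vector [- 1 / s, y]]"
  have AB: "A \<in> carrier SL2C" "B \<in> carrier SL2C"
    using s0 by (simp_all add: A_def B_def SL2C_simps det_2)
  have "- 1 / s - s = z" using s s0 by (simp add: field_simps power2_eq_square add_eq_0_iff)
  then have t: "trace A = x" "trace B = y" "trace (A \<otimes>\<^bsub>SL2C\<^esub> B) = z"
    by (simp_all add: A_def B_def SL2C_simps trace_def sum_2 matrix_matrix_mult_def)
  define \<sigma> where "\<sigma> = restrict (word_eval SL2C A B) (carrier \<Gamma>)"
  have h: "word_eval SL2C A B \<in> hom \<Gamma> SL2C" by (rule word_eval_hom[OF group_SL2C AB])
  have e: "\<sigma> elt_a = A" "\<sigma> elt_b = B" using word_eval_elt[OF group_SL2C AB] by (simp_all add: \<sigma>_def)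
  have sh: "\<sigma> \<in> hom \<Gamma> SL2C" using h by (auto simp: \<sigma>_def hom_def)
  have "\<sigma> comm_ab = A \<otimes>\<^bsub>SL2C\<^esub> B \<otimes>\<^bsub>SL2C\<^esub> inv\<^bsub>SL2C\<^esub> A \<otimes>\<^bsub>SL2C\<^esub> inv\<^bsub>SL2C\<^esub> B"
    unfolding comm_ab_def by (simp add: hom_Gamma_simps[OF group_SL2C sh] e)
  then have "trace (\<sigma> comm_ab) = \<tau>"
    using trace_commutator[OF AB] assms by (simp add: t cubic_surface_def)
  then have st: "\<sigma> \<in> tau_reps \<tau>" using sh by (simp add: tau_reps_def \<sigma>_def)
  then have X: "conj_rel \<tau> `` {\<sigma>} \<in> \<X> \<tau>" by (simp add: \<X>_def quotientI)
  moreover have "trace_coords (conj_rel \<tau> `` {\<sigma>}) = (x, y, z)"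
    using tr_eq[OF X equiv_class_self[OF equiv_conj_rel st]] 
    by (simp add: trace_coords_def e t hom_Gamma_simps[OF group_SL2C sh])
  ultimately show thesis by (rule that)
qed

lemma closed_cubic_surface: "closed (cubic_surface \<tau>)"
proof -
  have "cubic_surface \<tau> = {p. (fst p)\<^sup>2 + (fst (snd p))\<^sup>2 + (snd (snd p))\<^sup>2 - fst p * fst (snd p) * snd (snd p) = \<tau> + 2}"
    by (auto simp: cubic_surface_def)
  also have "closed \<dots>" by (intro closed_Collect_eq continuous_intros)
  finally show ?thesis .
qed

lemma limitin_X_topology:
  assumes "c \<in> \<X> \<tau>" "\<And>i. C i \<in> \<X> \<tau>" "(\<lambda>i. trace_coords (C i)) \<longlonglongrightarrow> trace_coords c"
  shows "limitin (X_topology \<tau>) C c sequentially"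
  unfolding limitin_def
proof (intro conjI allI impI)
  show "c \<in> topspace (X_topology \<tau>)" using assms(1) by (simp add: topspace_X_topology)
  fix U assume "openin (X_topology \<tau>) U \<and> c \<in> U"
  then obtain V where V: "open V" "U = trace_coords -` (cubic_surface \<tau> \<inter> V) \<inter> \<X> \<tau>" "c \<in> U"
    unfolding X_topology_def openin_pullback_topology by (auto simp: openin_open)
  then have "eventually (\<lambda>i. trace_coords (C i) \<in> V) sequentially"
    using assms(3) by (intro topological_tendstoD) auto
  then show "eventually (\<lambda>i. C i \<in> U) sequentially"
    by eventually_elim (use V assms(2) trace_coords_surface in auto)
qed

lemma bounded_orbit_converges:
  fixes \<phi> :: "nat \<Rightarrow> letter list \<Rightarrow> letter list"
  assumes r: "\<rho> \<in> tau_reps \<tau>" and p: "\<And>i. \<phi> i \<in> Aut_plus" and "inj (\<lambda>i. mapping_class (\<phi> i))"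
    and B: "\<And>i. cmod (trace (\<rho> (\<phi> i elt_a))) \<le> B" "\<And>i. cmod (trace (\<rho> (\<phi> i elt_b))) \<le> B"
      "\<And>i. cmod (trace (\<rho> (\<phi> i elt_a \<otimes>\<^bsub>\<Gamma>\<^esub> \<phi> i elt_b))) \<le> B"
  shows "\<exists>(H :: nat \<Rightarrow> (letter list \<Rightarrow> letter list) set) \<rho>\<^sub>0.
     inj H \<and> range H \<subseteq> carrier MCG \<and> \<rho>\<^sub>0 \<in> \<X> \<tau> \<and>
     limitin (X_topology \<tau>) (\<lambda>i. mcg_act (H i) (conj_rel \<tau> `` {\<rho>})) \<rho>\<^sub>0 sequentially"
proof -
  define C where "C i = mcg_act (mapping_class (\<phi> i)) (conj_rel \<tau> `` {\<rho>})" for i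
  note X = trace_coords_mcg_act[OF r p, folded C_def]
  have "bounded (range (\<lambda>i. trace_coords (C i)))"
  proof (rule boundedI)
    fix t assume "t \<in> range (\<lambda>i. trace_coords (C i))"
    then obtain i where "t = trace_coords (C i)" by blast
    moreover have "norm (x, y, z) \<le> cmod x + (cmod y + cmod z)" for x y z :: complex
      by (rule order_trans[OF norm_Pair_le add_left_mono[OF norm_Pair_le]])
    ultimately show "norm t \<le> B + (B + B)"
      using add_mono[OF B(1) add_mono[OF B(2,3)], of i i i] by (simp only: X(2)) (rule order_trans)
  qed
  then obtain l r where r: "strict_mono (r :: nat \<Rightarrow> nat)" and l: "((\<lambda>i. trace_coords (C i)) \<circ> r) \<longlonglongrightarrow> l"
    using bounded_imp_convergent_subsequence by blast
  have "l \<in> cubic_surface \<tau>"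
    using trace_coords_surface[OF X(1)] by (intro closed_sequentially[OF closed_cubic_surface _ l]) simp
  then obtain c where c: "c \<in> \<X> \<tau>" "trace_coords c = l"
    using trace_coords_surj by (metis prod_cases3)
  have "limitin (X_topology \<tau>) (\<lambda>i. C (r i)) c sequentially"
    using c l X(1) by (intro limitin_X_topology) (simp_all add: comp_def)
  moreover have "inj (\<lambda>i. mapping_class (\<phi> (r i)))"
    using inj_compose[OF assms(3) strict_mono_imp_inj_on[OF r]] by (simp add: comp_def)
  moreover have "range (\<lambda>i. mapping_class (\<phi> (r i))) \<subseteq> carrier MCG" using mapping_class_MCG p by blast
  ultimately show ?thesis using c(1) unfolding C_def by blast
qed

section \<open>Twists along an elliptic curve\<close>

lemma exponent_hom:
  obtains e :: "letter list \<Rightarrow> int" where "e \<in> hom \<Gamma> integer_group" "e elt_a = 1" "e elt_b = 0"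
  using that[OF word_eval_hom[OF group_integer_group]]
    word_eval_elt[OF group_integer_group, of 1 0] by simp

text \<open>
  In coordinates with respect to the basis \<open>(u, w)\<close>, the exponent sum of \<open>u\<close> in \<open>u\<^sup>n w\<close> is \<open>n\<close>, and
  exponent sums are invariant under conjugation.
\<close>

lemma mapping_class_twists_inj:
  assumes "free_basis u w" and p: "\<And>n. \<phi> n \<in> Aut_plus" "\<And>n. \<phi> n elt_a = u"
    "\<And>n. \<phi> n elt_b = ((\<otimes>\<^bsub>\<Gamma>\<^esub>) u ^^ n) w"
  shows "inj (\<lambda>n. mapping_class (\<phi> n))"
proof (rule injI)
  fix m n assume eq: "mapping_class (\<phi> m) = mapping_class (\<phi> n)"
  note cl = free_basis_closed[OF assms(1)]
  have pow: "((\<otimes>\<^bsub>\<Gamma>\<^esub>) u ^^ n) w \<in> carrier \<Gamma>" for n by (induction n) (simp_all add: cl)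
  obtain k where k: "k \<in> carrier \<Gamma>" "\<And>g. g \<in> carrier \<Gamma> \<Longrightarrow> \<phi> n g = conjugate k (\<phi> m g)"
    by (rule mapping_class_eqD[OF p(1) p(1) eq]) (rule that)
  obtain e :: "letter list \<Rightarrow> int" where e: "e \<in> hom \<Gamma> integer_group" "e elt_a = 1" "e elt_b = 0"
    by (rule exponent_hom)
  obtain \<phi>' where "\<phi>' \<in> auto \<Gamma>" "\<phi>' elt_a = u" "\<phi>' elt_b = w"
    using assms(1) by (auto simp: free_basis_iff_auto)
  moreover from auto_inverse[OF this(1)] obtain \<psi> where q: "\<psi> \<in> auto \<Gamma>" "\<forall>x\<in>carrier \<Gamma>. \<psi> (\<phi>' x) = x"
    by (elim bexE conjE) (rule that)
  ultimately have "\<psi> u = elt_a" "\<psi> w = elt_b" using ab_closed by metis+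
  define f where "f x = e (\<psi> x)" for x
  have f: "f (x \<otimes>\<^bsub>\<Gamma>\<^esub> y) = f x + f y" "f (inv\<^bsub>\<Gamma>\<^esub> x) = - f x"
    if "x \<in> carrier \<Gamma>" "y \<in> carrier \<Gamma>" for x y
    using that by (simp_all add: f_def auto_simps[OF q(1)] hom_Gamma_simps[OF group_integer_group e(1)])
  have uw: "f u = 1" "f w = 0" using e \<open>\<psi> u = elt_a\<close> \<open>\<psi> w = elt_b\<close> by (simp_all add: f_def)
  have fp: "f (((\<otimes>\<^bsub>\<Gamma>\<^esub>) u ^^ n) w) = int n" for n
    by (induction n) (simp_all add: uw f cl pow)
  have "f (\<phi> n elt_b) = f (\<phi> m elt_b)"
    using k(2)[of elt_b] k(1) pow[of m] by (simp add: p(3) conjugate_def f)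
  then show "m = n" by (simp add: p(3) fp)
qed

text \<open>
  The pairs \<open>(u, u\<^sup>n w)\<close> all have the orientation of \<open>(u, w)\<close>, since \<open>[u, u w] = u [u, w] u\<inverse>\<close>.
\<close>

lemma twists_exist:
  assumes "free_basis u v"
  obtains w \<phi> where "free_basis u w" "\<And>n. \<phi> n \<in> Aut_plus" "\<And>n. \<phi> n elt_a = u"
    "\<And>n. \<phi> n elt_b = ((\<otimes>\<^bsub>\<Gamma>\<^esub>) u ^^ n) w"
proof -
  obtain \<psi> where s: "\<psi> \<in> Aut_plus" "\<psi> elt_a = u"
    using free_basis_oriented[OF assms] by metis
  define w where "w = \<psi> elt_b"
  have uw: "free_basis u w" using s Aut_plus_auto[OF s(1)] by (auto simp: free_basis_iff_auto w_def)
  note cl = free_basis_closed[OF uw]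
  let ?w = "\<lambda>n. ((\<otimes>\<^bsub>\<Gamma>\<^esub>) u ^^ n) w"
  have pow: "?w n \<in> carrier \<Gamma>" for n by (induction n) (simp_all add: cl)
  have fb: "free_basis u (?w n)" for n by (induction n) (simp_all add: uw free_basis_mult)
  have "\<exists>k\<in>carrier \<Gamma>. commutator u (?w n) = conjugate k comm_ab" for n
  proof (induction n)
    case 0
    show ?case using s Aut_plus_commutator[OF Aut_plus_auto[OF s(1)]] by (simp add: w_def)
  next
    case (Suc n)
    then obtain k where "k \<in> carrier \<Gamma>" "commutator u (?w n) = conjugate k comm_ab" by blast
    then show ?case using cl(1) pow[of n] comm_ab_closed
      by (intro bexI[of _ "u \<otimes>\<^bsub>\<Gamma>\<^esub> k"]) (simp_all add: commutator_moves(4) conjugate_conjugate)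
  qed
  then have "\<exists>\<phi>. \<phi> \<in> Aut_plus \<and> \<phi> elt_a = u \<and> \<phi> elt_b = ?w n" for n
    using fb[of n] Aut_plus_commutator unfolding free_basis_iff_auto by metis
  then obtain \<phi> where "\<And>n. \<phi> n \<in> Aut_plus \<and> \<phi> n elt_a = u \<and> \<phi> n elt_b = ?w n" by metis
  then show thesis using that[OF uw] by blast
qed

lemma (in sl2_rep) twist_traces_bounded:
  assumes "u \<in> carrier \<Gamma>" "w \<in> carrier \<Gamma>" "T u = of_real x" "\<bar>x\<bar> < 2"
  obtains B where "\<And>n. cmod (T (((\<otimes>\<^bsub>\<Gamma>\<^esub>) u ^^ n) w)) \<le> B"
proof -
  have pow: "((\<otimes>\<^bsub>\<Gamma>\<^esub>) u ^^ n) w \<in> carrier \<Gamma>" for n using assms by (induction n) simp_all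
  show thesis
    by (rule elliptic_recurrence_bounded[OF assms(4), of "\<lambda>n. T (((\<otimes>\<^bsub>\<Gamma>\<^esub>) u ^^ n) w)"])
      (use that assms(1,3) pow in \<open>auto simp: T_mult_mult\<close>)
qed

section \<open>Representations that violate the BQ-conditions\<close>

lemma \<Omega>E:
  assumes "curve_class g \<in> \<Omega>"
  obtains u v where "free_basis u v" "curve_class g = curve_class u"
  using assms free_basis_swap unfolding \<Omega>_def by auto

theorem proposition2p4:
  fixes \<tau> :: complex and \<rho> :: "(letter list \<Rightarrow> complex^2^2) set"
  assumes "\<tau> \<noteq> 2"
    and "\<rho> \<in> \<X> \<tau>"
    and "\<not> extended_BQ \<rho>"
  shows "\<exists>(H :: nat \<Rightarrow> (letter list \<Rightarrow> letter list) set) \<rho>\<^sub>0.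
           inj H \<and> range H \<subseteq> carrier MCG \<and> \<rho>\<^sub>0 \<in> \<X> \<tau> \<and>
           limitin (X_topology \<tau>) (\<lambda>i. mcg_act (H i) \<rho>) \<rho>\<^sub>0 sequentially"
proof -
  obtain r where r: "r \<in> tau_reps \<tau>" "\<rho> = conj_rel \<tau> `` {r}"
    using assms(2) unfolding \<X>_def by (rule quotientE)
  interpret sl2_rep r by standard (use r(1) in \<open>simp add: tau_reps_def\<close>)
  have tr: "tr \<rho> g = T g" if "g \<in> carrier \<Gamma>" for g
    using tr_eq[OF assms(2) _ that] r equiv_class_self[OF equiv_conj_rel r(1)] by (simp add: T_def)
  have T_basis: "\<exists>u v. free_basis u v \<and> curve_class g = curve_class u \<and> tr \<rho> g = T u"
    if g: "g \<in> carrier \<Gamma>" "curve_class g \<in> \<Omega>" for g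
  proof -
    obtain u v where uv: "free_basis u v" "curve_class g = curve_class u" by (rule \<Omega>E[OF g(2)])
    moreover have "T g = T u" using curve_class_self[OF g(1)] uv(2) by (intro T_curve_class) simp
    ultimately show ?thesis using tr[OF g(1)] by metis
  qed
  from assms(3) consider
    (elliptic) g where "g \<in> carrier \<Gamma>" "curve_class g \<in> \<Omega>" "tr \<rho> g \<in> complex_of_real ` {-2<..<2}"
  | (infinite) "infinite {curve_class g | g. g \<in> carrier \<Gamma> \<and> curve_class g \<in> \<Omega> \<and> cmod (tr \<rho> g) \<le> 2}"
    unfolding extended_BQ_def by blast
  then show ?thesis
  proof cases
    case elliptic
    then obtain u v x where uv: "free_basis u v" "T u = of_real x" "\<bar>x\<bar> < 2"
      using T_basis[OF elliptic(1,2)] by (auto simp: abs_less_iff)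
    obtain w \<phi> where p: "free_basis u w" "\<And>n. \<phi> n \<in> Aut_plus" "\<And>n. \<phi> n elt_a = u"
      "\<And>n. \<phi> n elt_b = ((\<otimes>\<^bsub>\<Gamma>\<^esub>) u ^^ n) w"
      by (rule twists_exist[OF uv(1)]) (rule that)
    obtain B where B: "\<And>n. cmod (T (((\<otimes>\<^bsub>\<Gamma>\<^esub>) u ^^ n) w)) \<le> B"
      by (rule twist_traces_bounded[OF free_basis_closed[OF p(1)] uv(2,3)]) (rule that)
    show ?thesis
      unfolding r(2)
    proof (rule bounded_orbit_converges[OF r(1) p(2) mapping_class_twists_inj[OF p]])
      fix i
      show "cmod (trace (r (\<phi> i elt_a))) \<le> max 2 B"
        using uv(2,3) p(3) by (simp add: T_def)
      show "cmod (trace (r (\<phi> i elt_b))) \<le> max 2 B"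
        using B[of i] p(4)[of i] by (simp add: T_def le_max_iff_disj)
      show "cmod (trace (r (\<phi> i elt_a \<otimes>\<^bsub>\<Gamma>\<^esub> \<phi> i elt_b))) \<le> max 2 B"
        using B[of "Suc i"] p(3,4)[of i] by (simp add: T_def le_max_iff_disj)
    qed
  next
    case infinite
    define S where "S = {curve_class g | g. g \<in> carrier \<Gamma> \<and> curve_class g \<in> \<Omega> \<and> cmod (tr \<rho> g) \<le> 2}"
    have inf: "infinite S" using infinite by (simp add: S_def)
    have basis: "\<exists>u v. free_basis u v \<and> c = curve_class u \<and> cmod (T u) \<le> 2" if "c \<in> S" for c
      using that T_basis unfolding S_def by fastforce
    have "\<exists>\<phi>. \<phi> \<in> Aut_plus \<and> c = curve_class (\<phi> elt_a) \<and> cmod (T (\<phi> elt_a)) \<le> 2 \<and> cmod (T (\<phi> elt_b)) \<le> 2"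
      if c: "c \<in> S" for c
    proof -
      obtain u v where u: "free_basis u v" "c = curve_class u" "cmod (T u) \<le> 2"
        using basis[OF c] by (elim exE conjE) (rule that)
      (* A second small curve, as small_neighbour requires. *)
      have "S - {c} \<noteq> {}" using infinite_imp_nonempty[OF infinite_remove[OF inf]] by auto
      then obtain d where "d \<in> S" "d \<noteq> c" by blast
      then obtain g h where g: "free_basis g h" "d = curve_class g" "cmod (T g) \<le> 2"
        using basis[OF \<open>d \<in> S\<close>] by (elim exE conjE) (rule that)
      have "g \<notin> curve_class u" using curve_class_eq[of g u] u(2) g(2) \<open>d \<noteq> c\<close> by blast
      from small_neighbour[OF u(1,3) g(1,3) this] obtain w where w: "free_basis u w" "cmod (T w) \<le> 2"
        by (elim exE conjE) (rule that)
      obtain \<phi> where p: "\<phi> \<in> Aut_plus" "\<phi> elt_a = u" "\<phi> elt_b \<in> {w, inv\<^bsub>\<Gamma>\<^esub> w}"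
        by (rule free_basis_oriented[OF w(1)])
      then have "cmod (T (\<phi> elt_b)) \<le> 2"
        using w(2) T_inv[OF free_basis_closed(2)[OF w(1)]] by auto
      with p u show ?thesis by blast
    qed
    then obtain \<phi> where p: "\<And>c. c \<in> S \<Longrightarrow> \<phi> c \<in> Aut_plus \<and> c = curve_class (\<phi> c elt_a) \<and>
        cmod (T (\<phi> c elt_a)) \<le> 2 \<and> cmod (T (\<phi> c elt_b)) \<le> 2"
      by metis
    obtain c :: "nat \<Rightarrow> letter list set" where c: "inj c" "range c \<subseteq> S"
      using infinite_countable_subset[OF inf] by blast
    have q: "\<phi> (c i) \<in> Aut_plus" "c i = curve_class (\<phi> (c i) elt_a)"
      "cmod (T (\<phi> (c i) elt_a)) \<le> 2" "cmod (T (\<phi> (c i) elt_b)) \<le> 2" for i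
      using p[of "c i"] c(2) by blast+
    have "inj (\<lambda>i. mapping_class (\<phi> (c i)))"
    proof (rule injI)
      fix i j assume eq: "mapping_class (\<phi> (c i)) = mapping_class (\<phi> (c j))"
      obtain k where k: "k \<in> carrier \<Gamma>" "\<And>g. g \<in> carrier \<Gamma> \<Longrightarrow> \<phi> (c j) g = conjugate k (\<phi> (c i) g)"
        by (rule mapping_class_eqD[OF q(1) q(1) eq]) (rule that)
      have "\<phi> (c i) elt_a \<in> carrier \<Gamma>" using auto_simps(3)[OF Aut_plus_auto[OF q(1)]] by simp
      then have "\<phi> (c j) elt_a \<in> curve_class (\<phi> (c i) elt_a)"
        unfolding k(2)[OF ab_closed(1)] by (rule conjugate_in_curve_class) (rule k(1))
      then have "c j = c i" using curve_class_eq q(2) by metis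
      then show "i = j" using c(1) by (simp add: inj_eq)
    qed
    then show ?thesis
      unfolding r(2)
    proof (rule bounded_orbit_converges[OF r(1) q(1)])
      fix i
      have le: "(2::real) \<le> cmod \<tau> + 10" using norm_ge_zero[of \<tau>] by linarith
      show "cmod (trace (r (\<phi> (c i) elt_a))) \<le> cmod \<tau> + 10" "cmod (trace (r (\<phi> (c i) elt_b))) \<le> cmod \<tau> + 10"
        using q(3,4)[of i] le unfolding T_def by linarith+
      show "cmod (trace (r (\<phi> (c i) elt_a \<otimes>\<^bsub>\<Gamma>\<^esub> \<phi> (c i) elt_b))) \<le> cmod \<tau> + 10"
        using trace_coords_surface[OF trace_coords_mcg_act(1)[OF r(1) q(1)], of i] q(3,4)[of i]
        unfolding trace_coords_mcg_act(2)[OF r(1) q(1)] T_def by (rule cubic_surface_bounded)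
    qed
  qed
qed

end
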